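(* Let $(X,T)$ and $(Z,S)$ be minimal systems. Suppose that $\pi:X\to Y$ is an equicontinuous extension. If $Y$ and $Z$ are quasi-disjoint, then $X$ and $Z$ are quasi-disjoint.
   Context: A system $(X,T)$ is a compact metric space $X$ with a homeomorphism $T:X\to X$. It is minimal if every orbit $\{T^nx:n\in\mathbb Z\}$ is dense. A factor map (homomorphism, extension) $\pi:(X,T)\to(Y,S)$ is a continuous surjection with $\pi\circ T=S\circ\pi$. An extension $\pi$ is equicontinuous if for every $\epsilon>0$ there is $\delta>0$ such that $\pi(x_1)=\pi(x_2)$ and $\rho(x_1,x_2)<\delta$ imply $\rho(T^nx_1,T^nx_2)<\epsilon$ for all $n\in\mathbb Z$. A system is equicontinuous if for every $\epsilon>0$ there is $\delta>0$ such that $\rho(x,y)<\delta$ implies $\rho(T^nx,T^ny)<\epsilon$ for all $n\in\mathbb Z$. For a minimal system $(X,T)$, $\pi_X:X\to X_{eq}$ denotes its maximal equicontinuous factor (every factor map from $X$ to an equicontinuous system factors through $\pi_X$). A joining of two systems $(X,T)$ and $(Y,S)$ is a closed $T\times S$-invariant subset of $X\times Y$ with full projections onto $X$ and onto $Y$. Minimal systems $(X,T)$, $(Y,S)$ are quasi-disjoint if $X\times Y$ is the only joining $J$ of $X$ and $Y$ satisfying $(\pi_X\times\pi_Y)(J)=X_{eq}\times Y_{eq}$. *)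

theory Defs
  imports "HOL-Analysis.Analysis"
begin

text \<open>
  A system \<open>(X, T)\<close> is given by an abstract metric space \<open>X :: 'a metric\<close> with carrier
  \<open>mspace X\<close> and a map \<open>T\<close> of which only the values on \<open>mspace X\<close> matter.
\<close>

definition dyn_system :: "'a metric \<Rightarrow> ('a \<Rightarrow> 'a) \<Rightarrow> bool" where
  "dyn_system X T \<longleftrightarrow>
     compact_space (mtopology_of X) \<and> homeomorphic_map (mtopology_of X) (mtopology_of X) T"

text \<open>The iterate \<open>T\<^sup>n\<close> for \<open>n \<in> \<int>\<close>; the inverse is the inverse of \<open>T\<close> on the carrier.\<close>

definition int_iter :: "'a metric \<Rightarrow> ('a \<Rightarrow> 'a) \<Rightarrow> int \<Rightarrow> 'a \<Rightarrow> 'a" where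
  "int_iter X T n =
     (if n \<ge> 0 then T ^^ nat n else inv_into (mspace X) T ^^ nat (- n))"

definition minimal_system :: "'a metric \<Rightarrow> ('a \<Rightarrow> 'a) \<Rightarrow> bool" where
  "minimal_system X T \<longleftrightarrow> dyn_system X T \<and>
     (\<forall>x \<in> mspace X. mtopology_of X closure_of (range (\<lambda>n. int_iter X T n x)) = mspace X)"

definition factor_map ::
    "'a metric \<Rightarrow> ('a \<Rightarrow> 'a) \<Rightarrow> 'b metric \<Rightarrow> ('b \<Rightarrow> 'b) \<Rightarrow> ('a \<Rightarrow> 'b) \<Rightarrow> bool" where
  "factor_map X T Y S p \<longleftrightarrow> dyn_system X T \<and> dyn_system Y S \<and>
     continuous_map (mtopology_of X) (mtopology_of Y) p \<and>
     p ` mspace X = mspace Y \<and>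
     (\<forall>x \<in> mspace X. p (T x) = S (p x))"

definition equicontinuous_extension ::
    "'a metric \<Rightarrow> ('a \<Rightarrow> 'a) \<Rightarrow> 'b metric \<Rightarrow> ('b \<Rightarrow> 'b) \<Rightarrow> ('a \<Rightarrow> 'b) \<Rightarrow> bool" where
  "equicontinuous_extension X T Y S p \<longleftrightarrow> factor_map X T Y S p \<and>
     (\<forall>\<epsilon>>0. \<exists>\<delta>>0. \<forall>x1 \<in> mspace X. \<forall>x2 \<in> mspace X.
        p x1 = p x2 \<and> mdist X x1 x2 < \<delta> \<longrightarrow>
        (\<forall>n. mdist X (int_iter X T n x1) (int_iter X T n x2) < \<epsilon>))"

definition equicontinuous_system :: "'a metric \<Rightarrow> ('a \<Rightarrow> 'a) \<Rightarrow> bool" where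
  "equicontinuous_system X T \<longleftrightarrow> dyn_system X T \<and>
     (\<forall>\<epsilon>>0. \<exists>\<delta>>0. \<forall>x \<in> mspace X. \<forall>y \<in> mspace X.
        mdist X x y < \<delta> \<longrightarrow>
        (\<forall>n. mdist X (int_iter X T n x) (int_iter X T n y) < \<epsilon>))"

text \<open>
  HOL cannot quantify over types inside a definition, so the test systems \<open>W\<close> in the
  universal property have their carrier in the type of \<open>X\<close>. This loses nothing: every factor of
  \<open>X\<close> is isometric to one whose carrier is a set of representatives in \<open>X\<close> (lemma
  \<open>max_equicontinuous_factor_universal\<close> below).
\<close>

definition max_equicontinuous_factor ::
    "'a metric \<Rightarrow> ('a \<Rightarrow> 'a) \<Rightarrow> 'e metric \<Rightarrow> ('e \<Rightarrow> 'e) \<Rightarrow> ('a \<Rightarrow> 'e) \<Rightarrow> bool" where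
  "max_equicontinuous_factor X T E U p \<longleftrightarrow>
     factor_map X T E U p \<and> equicontinuous_system E U \<and>
     (\<forall>(W :: 'a metric) R q. equicontinuous_system W R \<and> factor_map X T W R q \<longrightarrow>
        (\<exists>r. factor_map E U W R r \<and> (\<forall>x \<in> mspace X. q x = r (p x))))"

definition joining ::
    "'a metric \<Rightarrow> ('a \<Rightarrow> 'a) \<Rightarrow> 'b metric \<Rightarrow> ('b \<Rightarrow> 'b) \<Rightarrow> ('a \<times> 'b) set \<Rightarrow> bool" where
  "joining X T Y S J \<longleftrightarrow>
     closedin (prod_topology (mtopology_of X) (mtopology_of Y)) J \<and>
     map_prod T S ` J = J \<and> fst ` J = mspace X \<and> snd ` J = mspace Y"

text \<open>
  The maximal equicontinuous factor is unique up to isomorphism, and the condition on the image of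
  \<open>J\<close> does not depend on its choice; all choices are quantified over. By the same set-of-representatives
  argument as above, it can be realised with carrier in the type of the system itself.
\<close>

definition quasi_disjoint ::
    "'a metric \<Rightarrow> ('a \<Rightarrow> 'a) \<Rightarrow> 'b metric \<Rightarrow> ('b \<Rightarrow> 'b) \<Rightarrow> bool" where
  "quasi_disjoint X T Y S \<longleftrightarrow>
     (\<forall>(Xeq :: 'a metric) T' pX (Yeq :: 'b metric) S' pY.
        max_equicontinuous_factor X T Xeq T' pX \<and> max_equicontinuous_factor Y S Yeq S' pY \<longrightarrow>
        {J. joining X T Y S J \<and> map_prod pX pY ` J = mspace Xeq \<times> mspace Yeq}
          = {mspace X \<times> mspace Y})"

lemma homeomorphic_map_isometric_copy:
  assumes "\<And>x. x \<in> mspace V \<Longrightarrow> f x \<in> mspace W \<and> g (f x) = x"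
    and "\<And>y. y \<in> mspace W \<Longrightarrow> g y \<in> mspace V \<and> f (g y) = y"
    and "\<And>x y. x \<in> mspace V \<Longrightarrow> y \<in> mspace V \<Longrightarrow> mdist W (f x) (f y) = mdist V x y"
  shows "homeomorphic_map (mtopology_of V) (mtopology_of W) f"
    and "homeomorphic_map (mtopology_of W) (mtopology_of V) g"
proof -
  have "Lipschitz_continuous_map V W f"
    unfolding Lipschitz_continuous_map_def using assms by (auto intro!: exI[of _ 1])
  moreover have "Lipschitz_continuous_map W V g"
    unfolding Lipschitz_continuous_map_def
  proof (intro conjI exI[of _ 1] ballI)
    show "g \<in> mspace W \<rightarrow> mspace V" using assms by auto
    fix x y assume "x \<in> mspace W" "y \<in> mspace W"
    then show "mdist V (g x) (g y) \<le> 1 * mdist W x y"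
      using assms(3)[of "g x" "g y"] assms(2) by simp
  qed
  ultimately have "homeomorphic_maps (mtopology_of V) (mtopology_of W) f g"
    using assms by (auto simp: homeomorphic_maps_def Lipschitz_continuous_imp_continuous_map)
  then show "homeomorphic_map (mtopology_of V) (mtopology_of W) f"
    and "homeomorphic_map (mtopology_of W) (mtopology_of V) g"
    using homeomorphic_maps_map by blast+
qed

lemma max_equicontinuous_factor_universal:
  fixes X :: "'a metric" and W :: "'w metric"
  assumes E: "max_equicontinuous_factor X T E U p"
    and W: "equicontinuous_system W R" and q: "factor_map X T W R q"
  shows "\<exists>r. factor_map E U W R r \<and> (\<forall>x \<in> mspace X. q x = r (p x))"
proof -
  define s where "s = inv_into (mspace X) q"
  define C where "C = s ` mspace W"
  define V where "V = metric (C, \<lambda>a b. mdist W (q a) (q b))"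
  define R' where "R' = s \<circ> R \<circ> q"
  have qim: "q ` mspace X = mspace W" and qcont: "continuous_map (mtopology_of X) (mtopology_of W) q"
    and qT: "\<And>x. x \<in> mspace X \<Longrightarrow> q (T x) = R (q x)" and sysX: "dyn_system X T"
    and sysW: "dyn_system W R"
    using q by (auto simp: factor_map_def)
  have qs: "q (s w) = w" if "w \<in> mspace W" for w
    unfolding s_def using that qim by (simp add: f_inv_into_f)
  have sq: "s (q a) = a" "q a \<in> mspace W" if "a \<in> C" for a
    using that qs by (auto simp: C_def)
  have "Metric_space C (\<lambda>a b. mdist W (q a) (q b))"
  proof
    fix a b c
    show "mdist W (q a) (q b) = mdist W (q b) (q a)" by (simp add: mdist_commute)
    assume "a \<in> C" "b \<in> C"
    then show "mdist W (q a) (q b) = 0 \<longleftrightarrow> a = b"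
      using sq by (metis mdist_zero)
    assume "c \<in> C"
    with \<open>a \<in> C\<close> \<open>b \<in> C\<close> show "mdist W (q a) (q c) \<le> mdist W (q a) (q b) + mdist W (q b) (q c)"
      using sq by (simp add: mdist_triangle)
  qed auto
  then have VC: "mspace V = C" and Vd: "mdist V = (\<lambda>a b. mdist W (q a) (q b))"
    by (simp_all add: V_def Metric_space.mspace_metric Metric_space.mdist_metric)
  have hom_q: "homeomorphic_map (mtopology_of V) (mtopology_of W) q"
    and hom_s: "homeomorphic_map (mtopology_of W) (mtopology_of V) s"
    using homeomorphic_map_isometric_copy[of V q W s] sq qs by (auto simp: VC Vd C_def)
  have Rhom: "homeomorphic_map (mtopology_of W) (mtopology_of W) R"
    using sysW by (simp add: dyn_system_def)
  have Rbij: "bij_betw R (mspace W) (mspace W)"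
    using homeomorphic_imp_injective_map[OF Rhom] homeomorphic_imp_surjective_map[OF Rhom]
    by (simp add: bij_betw_def)
  have R'hom: "homeomorphic_map (mtopology_of V) (mtopology_of V) R'"
    unfolding R'_def comp_assoc
    using homeomorphic_map_compose[OF homeomorphic_map_compose[OF hom_q Rhom] hom_s] by simp
  have R'bij: "bij_betw R' C C"
    using homeomorphic_imp_injective_map[OF R'hom] homeomorphic_imp_surjective_map[OF R'hom]
    by (simp add: VC bij_betw_def)
  have "compact_space (mtopology_of V)"
    using sysW hom_q homeomorphic_compact_space homeomorphic_map_imp_homeomorphic_space
    unfolding dyn_system_def by blast
  then have sysV: "dyn_system V R'" using R'hom by (simp add: dyn_system_def)
  have R's: "R' (s w) = s (R w)" if "w \<in> mspace W" for w
    using qs that by (simp add: R'_def)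
  have inv: "inv_into (mspace W) R w \<in> mspace W
      \<and> inv_into C R' (s w) = s (inv_into (mspace W) R w)" if "w \<in> mspace W" for w
  proof
    show *: "inv_into (mspace W) R w \<in> mspace W"
      using that Rbij by (metis bij_betw_def inv_into_into)
    have "R' (s (inv_into (mspace W) R w)) = s w"
      using R's[OF *] that Rbij by (simp add: bij_betw_inv_into_right)
    moreover have "s (inv_into (mspace W) R w) \<in> C" using * by (simp add: C_def)
    ultimately show "inv_into C R' (s w) = s (inv_into (mspace W) R w)"
      using R'bij by (metis bij_betw_inv_into_left)
  qed
  have pos: "(R ^^ k) w \<in> mspace W \<and> (R' ^^ k) (s w) = s ((R ^^ k) w)"
    if "w \<in> mspace W" for w k
    using that Rbij R's by (induction k) (auto simp: bij_betw_def)
  have neg: "(inv_into (mspace W) R ^^ k) w \<in> mspace W \<and>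
      (inv_into C R' ^^ k) (s w) = s ((inv_into (mspace W) R ^^ k) w)"
    if "w \<in> mspace W" for w k
    using that inv by (induction k) auto
  have iter: "int_iter W R n w \<in> mspace W" "int_iter V R' n (s w) = s (int_iter W R n w)"
    if "w \<in> mspace W" for w n
    using that pos neg by (auto simp: int_iter_def VC)
  have eqV: "equicontinuous_system V R'"
    unfolding equicontinuous_system_def
  proof (intro conjI sysV allI impI)
    fix \<epsilon> :: real assume "\<epsilon> > 0"
    then obtain \<delta> where \<delta>: "\<delta> > 0" and *: "\<And>x y n. x \<in> mspace W \<Longrightarrow> y \<in> mspace W \<Longrightarrow>
        mdist W x y < \<delta> \<Longrightarrow> mdist W (int_iter W R n x) (int_iter W R n y) < \<epsilon>"
      using W unfolding equicontinuous_system_def by meson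
    show "\<exists>\<delta>>0. \<forall>x \<in> mspace V. \<forall>y \<in> mspace V. mdist V x y < \<delta> \<longrightarrow>
        (\<forall>n. mdist V (int_iter V R' n x) (int_iter V R' n y) < \<epsilon>)"
      using \<delta> * iter qs by (intro exI[of _ \<delta>]) (auto simp: VC Vd C_def)
  qed
  have "factor_map X T V R' (s \<circ> q)"
    unfolding factor_map_def
  proof (intro conjI ballI sysX sysV)
    show "continuous_map (mtopology_of X) (mtopology_of V) (s \<circ> q)"
      using qcont hom_s by (meson continuous_map_compose homeomorphic_imp_continuous_map)
    show "(s \<circ> q) ` mspace X = mspace V"
      using qim by (metis VC C_def image_comp)
    fix x assume x: "x \<in> mspace X"
    then have "q x \<in> mspace W" using qim by blast
    with x show "(s \<circ> q) (T x) = R' ((s \<circ> q) x)" using qT R's by simp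
  qed
  then obtain r where r: "factor_map E U V R' r" "\<And>x. x \<in> mspace X \<Longrightarrow> s (q x) = r (p x)"
    using E eqV unfolding max_equicontinuous_factor_def by (metis comp_apply)
  have "factor_map E U W R (q \<circ> r)"
    unfolding factor_map_def
  proof (intro conjI ballI sysW)
    show "dyn_system E U" using r by (simp add: factor_map_def)
    show "continuous_map (mtopology_of E) (mtopology_of W) (q \<circ> r)"
      using r hom_q unfolding factor_map_def
      by (meson continuous_map_compose homeomorphic_imp_continuous_map)
    have rim: "r ` mspace E = C" using r by (simp add: factor_map_def VC)
    moreover have "q ` C = mspace W" using qs by (force simp: C_def)
    ultimately show "(q \<circ> r) ` mspace E = mspace W" by (metis image_comp)
    fix x assume x: "x \<in> mspace E"
    then have "r (U x) = R' (r x)" "r x \<in> C" using r rim by (auto simp: factor_map_def)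
    moreover from this have "R (q (r x)) \<in> mspace W" using sq Rbij by (meson bij_betwE)
    ultimately show "(q \<circ> r) (U x) = R ((q \<circ> r) x)" using qs by (simp add: R'_def)
  qed
  moreover have "q x = (q \<circ> r) (p x)" if "x \<in> mspace X" for x
  proof -
    have "q x \<in> mspace W" using qim that by blast
    then show ?thesis using r(2)[OF that, symmetric] qs by simp
  qed
  ultimately show ?thesis by blast
qed

end

theory Submission
  imports Defs
begin

text \<open>
  Let \<open>J\<close> be a joining of \<open>X\<close> and \<open>Z\<close> that maps onto the product of the maximal equicontinuous
  factors, and let \<open>N\<close> be the set of all \<open>(x, z)\<close> such that \<open>J\<close> contains some \<open>(x', z)\<close> with \<open>x'\<close>
  in the \<open>\<pi>\<close>-fibre of \<open>x\<close> and the orbits of \<open>x\<close> and \<open>x'\<close> uniformly \<open>\<epsilon>\<close>-close. This is a closed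
  invariant set, and the intersection of these sets over all \<open>\<epsilon>\<close> is \<open>J\<close>, so it suffices to show
  \<open>N = X \<times> Z\<close>.

  McMahon's argument: for an invariant measure on \<open>Z\<close>, the measure of the section \<open>N\<^sub>x\<close> is upper
  semicontinuous and invariant in \<open>x\<close>, hence constant; therefore the measure of the symmetric
  difference of \<open>N\<^sub>x\<close> and \<open>N\<^sub>y\<close> is a continuous invariant pseudometric on \<open>X\<close> and vanishes when
  \<open>x\<close> and \<open>y\<close> have the same image in the maximal equicontinuous factor. The same holds with \<open>X\<close>
  and \<open>Z\<close> exchanged. So if \<open>N\<close> misses a box \<open>P \<times> Q\<close>, it has no interior point over a suitable
  open set of \<open>X\<^sub>e\<^sub>q \<times> Z\<^sub>e\<^sub>q\<close>. On the other hand, quasi-disjointness of \<open>Y\<close> and \<open>Z\<close> forces the part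
  of \<open>J\<close> over any such open set to have an image with interior in \<open>Y \<times> Z\<close>, and equicontinuity of
  \<open>\<pi>\<close> turns this into interior points of \<open>N\<close>.
\<close>

subsection \<open>Compact metric spaces\<close>

lemma mdist_self: "x \<in> mspace X \<Longrightarrow> mdist X x x = 0"
  by simp

lemma Hausdorff_space_mtopology_of: "Hausdorff_space (mtopology_of X)"
  by (simp add: mtopology_of_def Metric_space.Hausdorff_space_mtopology)

lemma openin_mtopology_of:
  "openin (mtopology_of X) U \<longleftrightarrow>
    U \<subseteq> mspace X \<and> (\<forall>x\<in>U. \<exists>r>0. \<forall>y\<in>mspace X. mdist X x y < r \<longrightarrow> y \<in> U)"
  unfolding mtopology_of_def
  by (subst Metric_space.openin_mtopology[OF Metric_space_mspace_mdist])
    (fastforce simp: Metric_space.in_mball[OF Metric_space_mspace_mdist] subset_iff)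

lemma openin_mdist_ball:
  "x \<in> mspace X \<Longrightarrow> openin (mtopology_of X) {y \<in> mspace X. mdist X x y < r}"
  using openin_continuous_map_preimage[OF continuous_on_mdist, of x X "{..<r}"] by auto

lemma closedin_mdist_cball:
  "x \<in> mspace X \<Longrightarrow> closedin (mtopology_of X) {y \<in> mspace X. mdist X x y \<le> r}"
  using closedin_continuous_map_preimage[OF continuous_on_mdist, of x X "{..r}"] by auto

lemma compact_metric_finite_net:
  assumes "compact_space (mtopology_of X)" "r > 0"
  obtains K where "finite K" "K \<subseteq> mspace X" "\<And>x. x \<in> mspace X \<Longrightarrow> \<exists>a\<in>K. mdist X a x < r"
proof -
  interpret Metric_space "mspace X" "mdist X" by (rule Metric_space_mspace_mdist)
  have "mtotally_bounded (mspace X)"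
    using assms compactin_imp_mtotally_bounded[of "mspace X"]
    by (simp add: mtopology_of_def compact_space_def)
  then show ?thesis using that assms(2) unfolding mtotally_bounded_def by fastforce
qed

text \<open>A finite form of Baire's theorem: if \<open>G\<close> is not inside one of the closed
  sets, removing that set leaves a nonempty open set covered by the remaining ones.\<close>

lemma finite_closed_Union_interior:
  assumes "finite I" "\<And>i. i \<in> I \<Longrightarrow> closedin X (C i)"
    and "openin X G" "G \<noteq> {}" "G \<subseteq> (\<Union>i\<in>I. C i)"
  obtains i G' where "i \<in> I" "openin X G'" "G' \<noteq> {}" "G' \<subseteq> G" "G' \<subseteq> C i"
  using assms
proof (induction I arbitrary: G thesis rule: finite_induct)
  case empty
  then show ?case by simp
next
  case (insert i I)
  show ?case
  proof (cases "G \<subseteq> C i")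
    case True
    then show ?thesis using insert.prems by blast
  next
    case False
    have "openin X (G - C i)" using insert.prems by blast
    moreover have "G - C i \<subseteq> (\<Union>i\<in>I. C i)" using insert.prems by auto
    ultimately show ?thesis
      using insert.IH[of "G - C i"] insert.prems False by (metis Diff_subset Diff_eq_empty_iff insertCI order_trans)
  qed
qed

subsection \<open>Iterates\<close>

lemma dyn_system_bij_betw: "dyn_system X T \<Longrightarrow> bij_betw T (mspace X) (mspace X)"
  unfolding dyn_system_def bij_betw_def
  using homeomorphic_imp_injective_map homeomorphic_imp_surjective_map by fastforce

lemma dyn_system_in: "dyn_system X T \<Longrightarrow> x \<in> mspace X \<Longrightarrow> T x \<in> mspace X"
  using dyn_system_bij_betw bij_betwE by blast

lemma funpow_in: "dyn_system X T \<Longrightarrow> x \<in> mspace X \<Longrightarrow> (T ^^ k) x \<in> mspace X"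
  by (induction k) (auto simp: dyn_system_in)

lemma int_iter_0 [simp]: "int_iter X T 0 x = x"
  by (simp add: int_iter_def)

lemma int_iter_of_nat: "int_iter X T (int k) x = (T ^^ k) x"
  by (simp add: int_iter_def)

lemma int_iter_in:
  assumes "dyn_system X T" "x \<in> mspace X" shows "int_iter X T n x \<in> mspace X"
proof -
  have "(inv_into (mspace X) T ^^ k) x \<in> mspace X" for k
    by (induction k)
      (use assms dyn_system_bij_betw[OF assms(1)] in \<open>auto simp: bij_betw_def inv_into_into\<close>)
  then show ?thesis using assms by (auto simp: int_iter_def funpow_in)
qed

lemma int_iter_Suc:
  assumes "dyn_system X T" "x \<in> mspace X"
  shows "int_iter X T (n + 1) x = T (int_iter X T n x)"
proof (cases "n \<ge> 0")
  case True
  then show ?thesis by (simp add: int_iter_def nat_add_distrib)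
next
  case False
  \<comment> \<open>Here \<open>n + 1 = - int k\<close>, so one more inverse turns the iterate
    \<open>n + 1\<close> into the iterate \<open>n\<close>. The case \<open>k = 0\<close> is
    separate because \<open>int_iter\<close> computes the exponent \<open>0\<close> by its
    nonnegative branch.\<close>
  define k where "k = nat (- n - 1)"
  have n: "n = - int (Suc k)" using False by (simp add: k_def)
  define y where "y = int_iter X T (n + 1) x"
  have y: "y \<in> mspace X" unfolding y_def by (rule int_iter_in[OF assms])
  have "int_iter X T n x = inv_into (mspace X) T y"
    by (cases k) (auto simp: int_iter_def n y_def nat_add_distrib)
  then show ?thesis
    using y assms dyn_system_bij_betw[of X T] by (simp add: bij_betw_inv_into_right flip: y_def)
qed

lemma int_iter_add:
  assumes "dyn_system X T" "x \<in> mspace X"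
  shows "int_iter X T (m + n) x = int_iter X T m (int_iter X T n x)"
proof (induction m rule: int_induct[where k = 0])
  case base
  show ?case by simp
next
  case (step1 i)
  then show ?case
    using int_iter_Suc[OF assms, of "i + n"] int_iter_Suc[OF assms(1) int_iter_in[OF assms, of n], of i]
    by (simp add: algebra_simps)
next
  case (step2 i)
  \<comment> \<open>Downwards, the two sides are compared after one application of \<open>T\<close>,
    which is injective on the carrier.\<close>
  have "T (int_iter X T (i - 1 + n) x) = T (int_iter X T (i - 1) (int_iter X T n x))"
    using step2 int_iter_Suc[OF assms, of "i - 1 + n"]
      int_iter_Suc[OF assms(1) int_iter_in[OF assms, of n], of "i - 1"]
    by (simp add: algebra_simps)
  then show ?case
    using dyn_system_bij_betw[OF assms(1)] int_iter_in[OF assms(1)] assms(2)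
    by (metis bij_betw_def inj_on_def)
qed

lemma int_iter_shift:
  assumes "dyn_system X T" "x \<in> mspace X"
  shows "int_iter X T n (T x) = int_iter X T (n + 1) x"
  using int_iter_add[OF assms, of n 1] by (simp add: int_iter_def)

lemma int_iter_inverse:
  assumes "dyn_system X T" "x \<in> mspace X"
  shows "int_iter X T n (int_iter X T (- n) x) = x" "int_iter X T (- n) (int_iter X T n x) = x"
  using int_iter_add[OF assms, of n "- n"] int_iter_add[OF assms, of "- n" n] by simp_all

lemma factor_map_int_iter:
  assumes "factor_map X T Y S p" "x \<in> mspace X"
  shows "p (int_iter X T n x) = int_iter Y S n (p x)"
proof -
  have X: "dyn_system X T" and Y: "dyn_system Y S" and p: "\<And>x. x \<in> mspace X \<Longrightarrow> p x \<in> mspace Y"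
    and pT: "\<And>x. x \<in> mspace X \<Longrightarrow> p (T x) = S (p x)"
    using assms by (auto simp: factor_map_def)
  show ?thesis
  proof (induction n rule: int_induct[where k = 0])
    case base
    show ?case by simp
  next
    case (step1 i)
    then show ?case
      using pT[OF int_iter_in[OF X assms(2), of i]] p[OF assms(2)] int_iter_Suc[OF X assms(2), of i]
        int_iter_Suc[OF Y, of "p x" i] by metis
  next
    case (step2 i)
    have "S (p (int_iter X T (i - 1) x)) = S (int_iter Y S (i - 1) (p x))"
      using step2 int_iter_in[OF X assms(2)] pT p[OF assms(2)] int_iter_Suc[OF X assms(2), of "i - 1"]
        int_iter_Suc[OF Y, of "p x" "i - 1"] by (metis diff_add_cancel)
    then show ?case
      using dyn_system_bij_betw[OF Y] int_iter_in[OF Y] int_iter_in[OF X assms(2)] p assms(2)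
      by (metis bij_betw_def inj_on_def)
  qed
qed

lemma continuous_map_funpow: "continuous_map X X f \<Longrightarrow> continuous_map X X (f ^^ k)"
proof (induction k)
  case (Suc k)
  then show ?case using continuous_map_compose[of X X "f ^^ k" X f] by (simp add: comp_def)
qed simp

lemma homeomorphic_map_int_iter:
  assumes "dyn_system X T"
  shows "homeomorphic_map (mtopology_of X) (mtopology_of X) (int_iter X T n)"
proof -
  have T: "homeomorphic_map (mtopology_of X) (mtopology_of X) T"
    using assms by (simp add: dyn_system_def)
  have pos: "continuous_map (mtopology_of X) (mtopology_of X) (T ^^ k)" for k
    using T by (simp add: continuous_map_funpow homeomorphic_imp_continuous_map)
  have "continuous_map (mtopology_of X) (mtopology_of X) (inv_into (mspace X) T)"
  proof -
    obtain g where g: "homeomorphic_maps (mtopology_of X) (mtopology_of X) T g"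
      using T homeomorphic_map_maps by blast
    then have cg: "continuous_map (mtopology_of X) (mtopology_of X) g"
      and gx: "\<And>x. x \<in> mspace X \<Longrightarrow> T (g x) = x"
      by (auto simp: homeomorphic_maps_def)
    have gim: "g x \<in> mspace X" if "x \<in> mspace X" for x
      using continuous_map_image_subset_topspace[OF cg] that by auto
    show ?thesis
    proof (rule continuous_map_eq[OF cg])
      fix x assume "x \<in> topspace (mtopology_of X)"
      then show "g x = inv_into (mspace X) T x"
        using bij_betw_inv_into_left[OF dyn_system_bij_betw[OF assms] gim[of x]] gx[of x] by simp
    qed
  qed
  then have neg: "continuous_map (mtopology_of X) (mtopology_of X) (inv_into (mspace X) T ^^ k)" for k
    by (rule continuous_map_funpow)
  have cont: "continuous_map (mtopology_of X) (mtopology_of X) (int_iter X T n)" for n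
    using pos neg by (simp add: int_iter_def)
  show ?thesis
    unfolding homeomorphic_map_maps homeomorphic_maps_def
    by (rule exI[of _ "int_iter X T (- n)"]) (simp add: cont int_iter_inverse[OF assms])
qed

subsection \<open>Minimal systems\<close>

lemma minimal_system_dyn: "minimal_system X T \<Longrightarrow> dyn_system X T"
  by (simp add: minimal_system_def)

text \<open>Density of all orbits means that the preimages of \<open>U\<close> under the integer
  iterates cover the space. Compactness leaves finitely many of them, and a shift makes the
  remaining times nonnegative with a common bound.\<close>

lemma minimal_bounded_return:
  assumes X: "minimal_system X T" and U: "openin (mtopology_of X) U" "U \<noteq> {}"
  obtains K where "\<And>x. x \<in> mspace X \<Longrightarrow> \<exists>j\<le>K. (T ^^ j) x \<in> U"
proof -
  have sys: "dyn_system X T" using X by (rule minimal_system_dyn)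
  define P where "P n = {x \<in> mspace X. int_iter X T n x \<in> U}" for n
  have op: "openin (mtopology_of X) (P n)" for n
    using openin_continuous_map_preimage[OF homeomorphic_imp_continuous_map[OF
          homeomorphic_map_int_iter[OF sys]] U(1)] by (simp add: P_def)
  have "\<exists>n. x \<in> P n" if x: "x \<in> mspace X" for x
  proof -
    obtain u where "u \<in> U" using U by blast
    then have "u \<in> mtopology_of X closure_of (range (\<lambda>n. int_iter X T n x))"
      using X x openin_subset[OF U(1)] by (auto simp: minimal_system_def)
    then show ?thesis using U(1) \<open>u \<in> U\<close> x unfolding in_closure_of P_def by blast
  qed
  then have "topspace (mtopology_of X) \<subseteq> \<Union>(range P)" by auto
  then obtain F where F: "finite F" "F \<subseteq> range P" "mspace X \<subseteq> \<Union>F"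
    using sys op unfolding dyn_system_def compact_space_alt by (metis rangeE topspace_mtopology_of)
  then obtain I where I: "finite I" "mspace X \<subseteq> (\<Union>n\<in>I. P n)"
    by (metis finite_subset_image)
  obtain k where k: "\<And>n. n \<in> I \<Longrightarrow> \<bar>n\<bar> \<le> int k"
  proof -
    have "\<bar>n\<bar> \<le> int (nat (\<Sum>i\<in>I. \<bar>i\<bar>))" if "n \<in> I" for n
      using member_le_sum[of n I "\<lambda>i. \<bar>i\<bar>"] that I by (simp add: sum_nonneg)
    then show ?thesis using that by blast
  qed
  show ?thesis
  \<comment> \<open>Starting from the \<open>k\<close>-th iterate of \<open>x\<close> replaces a
    time \<open>n\<close> with \<open>\<bar>n\<bar> \<le> k\<close> by \<open>n + k\<close>, which
    lies between \<open>0\<close> and \<open>2 * k\<close>.\<close>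
  proof (rule that[of "2 * k"])
    fix x assume x: "x \<in> mspace X"
    then obtain n where n: "n \<in> I" "int_iter X T k x \<in> P n"
      using I int_iter_in[OF sys x] by blast
    then have "(T ^^ nat (n + k)) x \<in> U"
      using int_iter_add[OF sys x, of n k] k[of n] by (simp add: P_def int_iter_def split: if_splits)
    moreover have "nat (n + k) \<le> 2 * k" using k[of n] n by auto
    ultimately show "\<exists>j\<le>2 * k. (T ^^ j) x \<in> U" by blast
  qed
qed

text \<open>Return times to the open complement of \<open>A\<close> can be taken nonnegative, so
  forward invariance is enough to contradict a visit there.\<close>

lemma minimal_closed_invariant:
  assumes X: "minimal_system X T" and A: "closedin (mtopology_of X) A" "T ` A \<subseteq> A" "A \<noteq> {}"
  shows "A = mspace X"
proof (rule ccontr)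
  assume "A \<noteq> mspace X"
  then have "mspace X - A \<noteq> {}" using closedin_subset[OF A(1)] by auto
  moreover have "openin (mtopology_of X) (mspace X - A)" using A(1) by (metis closedin_def topspace_mtopology_of)
  ultimately obtain K where K: "\<And>x. x \<in> mspace X \<Longrightarrow> \<exists>j\<le>K. (T ^^ j) x \<in> mspace X - A"
    using minimal_bounded_return[OF X] by blast
  obtain a where a: "a \<in> A" using A by blast
  have "(T ^^ j) a \<in> A" for j
    by (induction j) (use a A in auto)
  moreover have "a \<in> mspace X" using a closedin_subset[OF A(1)] by auto
  ultimately show False using K by blast
qed

lemma minimal_factor:
  assumes X: "minimal_system X T" and p: "factor_map X T Y S p"
  shows "minimal_system Y S"
  unfolding minimal_system_def
proof (intro conjI ballI)
  show Y: "dyn_system Y S" using p by (simp add: factor_map_def)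
  have cont: "continuous_map (mtopology_of X) (mtopology_of Y) p" and im: "p ` mspace X = mspace Y"
    using p by (auto simp: factor_map_def)
  fix y assume "y \<in> mspace Y"
  then obtain x where x: "x \<in> mspace X" "y = p x" using im by blast
  show "mtopology_of Y closure_of range (\<lambda>n. int_iter Y S n y) = mspace Y" (is "?C = _")
  proof
    show "?C \<subseteq> mspace Y" using closure_of_subset_topspace by fastforce
    have "p ` mspace X = p ` (mtopology_of X closure_of range (\<lambda>n. int_iter X T n x))"
      using X x by (simp add: minimal_system_def)
    also have "\<dots> \<subseteq> mtopology_of Y closure_of (p ` range (\<lambda>n. int_iter X T n x))"
      using cont by (rule continuous_map_image_closure_subset)
    also have "p ` range (\<lambda>n. int_iter X T n x) = range (\<lambda>n. int_iter Y S n y)"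
      unfolding image_image factor_map_int_iter[OF p x(1)] x(2) ..
    finally show "mspace Y \<subseteq> ?C" using im by simp
  qed
qed

text \<open>Finitely many preimages of a closed ball inside \<open>V\<close> under iterates cover
  \<open>X\<close>. Their images are closed and cover \<open>Y\<close>, so one of them has interior,
  and the corresponding iterate of \<open>S\<close> carries this interior into the image of
  \<open>V\<close>.\<close>

lemma minimal_factor_semiopen:
  assumes X: "minimal_system X T" and p: "factor_map X T Y S p"
    and V: "openin (mtopology_of X) V" "V \<noteq> {}"
  obtains G where "openin (mtopology_of Y) G" "G \<noteq> {}" "G \<subseteq> p ` V"
proof -
  have sys: "dyn_system X T" using X by (rule minimal_system_dyn)
  have Y: "dyn_system Y S" and cont: "continuous_map (mtopology_of X) (mtopology_of Y) p"
    and im: "p ` mspace X = mspace Y"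
    using p by (auto simp: factor_map_def)
  obtain v where v: "v \<in> V" "v \<in> mspace X" using V openin_subset[OF V(1)] by auto
  obtain r where r: "r > 0" "\<And>y. y \<in> mspace X \<Longrightarrow> mdist X v y < r \<Longrightarrow> y \<in> V"
    using V(1) v(1) unfolding openin_mtopology_of by meson
  \<comment> \<open>The closed ball makes the images of its preimages closed; the open ball of the
    same radius supplies the bounded return times.\<close>
  define B where "B = {y \<in> mspace X. mdist X v y \<le> r / 2}"
  have Bcl: "closedin (mtopology_of X) B"
    unfolding B_def using v(2) by (rule closedin_mdist_cball)
  have BV: "B \<subseteq> V"
    using r by (auto simp: B_def)
  let ?U = "{y \<in> mspace X. mdist X v y < r / 2}"
  have "openin (mtopology_of X) ?U" using v(2) by (rule openin_mdist_ball)
  moreover have "v \<in> ?U" using v r by (simp add: mdist_self)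
  then have "?U \<noteq> {}" by blast
  ultimately obtain K where K: "\<And>x. x \<in> mspace X \<Longrightarrow> \<exists>j\<le>K. (T ^^ j) x \<in> ?U"
    using minimal_bounded_return[OF X] by metis
  have pcl: "closed_map (mtopology_of X) (mtopology_of Y) p"
    using continuous_imp_closed_map[OF cont] sys Hausdorff_space_mtopology_of by (auto simp: dyn_system_def)
  define C where "C j = {x \<in> mspace X. int_iter X T (int j) x \<in> B}" for j
  have Ccl: "closedin (mtopology_of Y) (p ` C j)" for j
  proof -
    have "closedin (mtopology_of X) (C j)"
      using closedin_continuous_map_preimage[OF homeomorphic_imp_continuous_map[OF
          homeomorphic_map_int_iter[OF sys]] Bcl] by (simp add: C_def)
    then show ?thesis using pcl by (simp add: closed_map_def)
  qed
  have "mspace X \<subseteq> (\<Union>j\<le>K. C j)"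
  proof
    fix x assume x: "x \<in> mspace X"
    then obtain j where "j \<le> K" "(T ^^ j) x \<in> ?U" using K by blast
    then show "x \<in> (\<Union>j\<le>K. C j)" using x by (auto simp: C_def B_def int_iter_of_nat)
  qed
  then have cov: "mspace Y \<subseteq> (\<Union>j\<in>{..K}. p ` C j)" using im by fastforce
  have ne: "mspace Y \<noteq> {}" using v im by auto
  have "openin (mtopology_of Y) (mspace Y)" by (metis openin_topspace topspace_mtopology_of)
  then obtain j G where G: "openin (mtopology_of Y) G" "G \<noteq> {}" "G \<subseteq> p ` C j"
    using finite_closed_Union_interior[OF finite_atMost Ccl _ ne cov] by metis
  show ?thesis
  proof (rule that[of "int_iter Y S (int j) ` G"])
    show "openin (mtopology_of Y) (int_iter Y S (int j) ` G)"
      using homeomorphic_map_int_iter[OF Y] G(1) homeomorphic_imp_open_map open_map_def by blast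
    show "int_iter Y S (int j) ` G \<noteq> {}" using G by simp
    show "int_iter Y S (int j) ` G \<subseteq> p ` V"
    proof
      fix w assume "w \<in> int_iter Y S (int j) ` G"
      then obtain x where "x \<in> C j" "w = int_iter Y S (int j) (p x)" using G(3) by blast
      then have "w = p (int_iter X T (int j) x)" "int_iter X T (int j) x \<in> V"
        using BV factor_map_int_iter[OF p] by (auto simp: C_def)
      then show "w \<in> p ` V" by blast
    qed
  qed
qed

subsection \<open>Invariant pseudometrics and equicontinuous factors\<close>

text \<open>Continuity is asked only along the diagonal, with the first argument fixed; together
  with the triangle inequality this gives joint continuity. Nonnegativity follows from the other
  axioms.\<close>

definition invariant_pseudometric :: "'a metric \<Rightarrow> ('a \<Rightarrow> 'a) \<Rightarrow> ('a \<Rightarrow> 'a \<Rightarrow> real) \<Rightarrow> bool" where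
  "invariant_pseudometric X T D \<longleftrightarrow>
     (\<forall>x\<in>mspace X. D x x = 0) \<and>
     (\<forall>x\<in>mspace X. \<forall>y\<in>mspace X. D x y = D y x) \<and>
     (\<forall>x\<in>mspace X. \<forall>y\<in>mspace X. \<forall>z\<in>mspace X. D x z \<le> D x y + D y z) \<and>
     (\<forall>x\<in>mspace X. \<forall>y\<in>mspace X. D (T x) (T y) = D x y) \<and>
     (\<forall>x\<in>mspace X. \<forall>\<epsilon>>0. \<exists>\<delta>>0. \<forall>y\<in>mspace X. mdist X x y < \<delta> \<longrightarrow> D x y < \<epsilon>)"

context
  fixes X :: "'a metric" and T :: "'a \<Rightarrow> 'a" and D :: "'a \<Rightarrow> 'a \<Rightarrow> real"
  assumes D: "invariant_pseudometric X T D"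
begin

lemma invariant_pseudometric_zero: "x \<in> mspace X \<Longrightarrow> D x x = 0"
  and invariant_pseudometric_sym: "x \<in> mspace X \<Longrightarrow> y \<in> mspace X \<Longrightarrow> D x y = D y x"
  and invariant_pseudometric_triangle: "x \<in> mspace X \<Longrightarrow> y \<in> mspace X \<Longrightarrow> z \<in> mspace X \<Longrightarrow> D x z \<le> D x y + D y z"
  and invariant_pseudometric_invariant: "x \<in> mspace X \<Longrightarrow> y \<in> mspace X \<Longrightarrow> D (T x) (T y) = D x y"
  using D unfolding invariant_pseudometric_def by blast+

lemma invariant_pseudometric_continuous:
  assumes "x \<in> mspace X" "\<epsilon> > 0"
  obtains \<delta> where "\<delta> > 0" "\<And>y. y \<in> mspace X \<Longrightarrow> mdist X x y < \<delta> \<Longrightarrow> D x y < \<epsilon>"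
  using D assms unfolding invariant_pseudometric_def by meson

lemma invariant_pseudometric_nonneg: "x \<in> mspace X \<Longrightarrow> y \<in> mspace X \<Longrightarrow> 0 \<le> D x y"
  using invariant_pseudometric_triangle[of x y x] invariant_pseudometric_sym[of x y] invariant_pseudometric_zero[of x] by simp

lemma invariant_pseudometric_cong:
  assumes "x \<in> mspace X" "y \<in> mspace X" "x' \<in> mspace X" "y' \<in> mspace X" "D x x' = 0" "D y y' = 0"
  shows "D x y = D x' y'"
  using invariant_pseudometric_triangle[of x x' y] invariant_pseudometric_triangle[of x' y' y] invariant_pseudometric_triangle[of x' x y'] invariant_pseudometric_triangle[of x y y']
    invariant_pseudometric_sym[of x x'] invariant_pseudometric_sym[of y y'] assms by simp

end

section \<open>Correspondence between invariant pseudometrics and equicontinuous factors\<close>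

lemma isometric_equicontinuous:
  assumes W: "dyn_system W R"
    and iso: "\<And>x y. x \<in> mspace W \<Longrightarrow> y \<in> mspace W \<Longrightarrow> mdist W (R x) (R y) = mdist W x y"
  shows "equicontinuous_system W R"
proof -
  have "mdist W (int_iter W R n x) (int_iter W R n y) = mdist W x y"
    if xy: "x \<in> mspace W" "y \<in> mspace W" for x y n
  proof (induction n rule: int_induct[where k = 0])
    case base
    show ?case by simp
  next
    case (step1 i)
    then show ?case
      using int_iter_Suc[OF W xy(1)] int_iter_Suc[OF W xy(2)] iso int_iter_in[OF W] xy by simp
  next
    case (step2 i)
    then show ?case
      using int_iter_Suc[OF W xy(1), of "i - 1"] int_iter_Suc[OF W xy(2), of "i - 1"]
        iso[OF int_iter_in[OF W xy(1), of "i - 1"] int_iter_in[OF W xy(2), of "i - 1"]] by simp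
  qed
  then show ?thesis using W unfolding equicontinuous_system_def by auto
qed

text \<open>Points at \<open>D\<close>-distance zero are identified by choosing a representative of
  each class, which keeps the carrier of the quotient in the type of \<open>X\<close>. The map
  induced by \<open>T\<close> is an isometry for \<open>D\<close>, hence equicontinuous.\<close>

lemma quotient_by_pseudometric:
  fixes X :: "'a metric"
  assumes X: "dyn_system X T" and D: "invariant_pseudometric X T D"
  obtains W :: "'a metric" and R q
  where "equicontinuous_system W R" "factor_map X T W R q"
    "\<And>x y. x \<in> mspace X \<Longrightarrow> y \<in> mspace X \<Longrightarrow> mdist W (q x) (q y) = D x y"
proof -
  note zero = invariant_pseudometric_zero[OF D] and sym = invariant_pseudometric_sym[OF D] and tri = invariant_pseudometric_triangle[OF D]
    and inv = invariant_pseudometric_invariant[OF D] and cong = invariant_pseudometric_cong[OF D] and nn = invariant_pseudometric_nonneg[OF D]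
  \<comment> \<open>The predicate under \<open>SOME\<close> depends only on the class of
    \<open>x\<close>, so equivalent points receive literally the same representative.\<close>
  define q where "q x = (SOME y. y \<in> mspace X \<and> D x y = 0)" for x
  have q: "q x \<in> mspace X" "D x (q x) = 0" if "x \<in> mspace X" for x
    using someI[of "\<lambda>y. y \<in> mspace X \<and> D x y = 0" x] that zero by (auto simp: q_def)
  have q_eq: "q x = q y" if xy: "x \<in> mspace X" "y \<in> mspace X" "D x y = 0" for x y
  proof -
    have "D x z = D y z" if "z \<in> mspace X" for z
      using cong[of x z y z] that xy zero by simp
    then show ?thesis unfolding q_def by metis
  qed
  define C where "C = q ` mspace X"
  have Cin: "a \<in> mspace X" if "a \<in> C" for a using that q by (auto simp: C_def)
  have qC: "q a = a" if "a \<in> C" for a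
    using that q q_eq sym by (auto simp: C_def)
  define R where "R = q \<circ> T"
  \<comment> \<open>The value \<open>0\<close> outside \<open>C\<close> is there because
    \<open>Metric_space\<close> demands nonnegativity and symmetry for all arguments, not only on
    the carrier.\<close>
  define d where "d = (\<lambda>a b. if a \<in> C \<and> b \<in> C then D a b else 0)"
  have M: "Metric_space C d"
    unfolding d_def
  proof
    fix a b c
    show "0 \<le> (if a \<in> C \<and> b \<in> C then D a b else 0)" using nn Cin by auto
    show "(if a \<in> C \<and> b \<in> C then D a b else 0) = (if b \<in> C \<and> a \<in> C then D b a else 0)"
      using sym Cin by auto
    assume ab: "a \<in> C" "b \<in> C"
    then show "(if a \<in> C \<and> b \<in> C then D a b else 0) = 0 \<longleftrightarrow> a = b"
      using q_eq[of a b] qC Cin zero by auto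
    assume "c \<in> C"
    then show "(if a \<in> C \<and> c \<in> C then D a c else 0)
        \<le> (if a \<in> C \<and> b \<in> C then D a b else 0) + (if b \<in> C \<and> c \<in> C then D b c else 0)"
      using ab tri Cin by auto
  qed
  define W where "W = metric (C, d)"
  have WC: "mspace W = C" and Wd: "\<And>a b. a \<in> C \<Longrightarrow> b \<in> C \<Longrightarrow> mdist W a b = D a b"
    unfolding W_def Metric_space.mspace_metric[OF M] Metric_space.mdist_metric[OF M]
    by (simp_all add: d_def)
  have qCin: "q x \<in> C" if "x \<in> mspace X" for x using that by (simp add: C_def)
  have qd: "mdist W (q x) (q y) = D x y" if "x \<in> mspace X" "y \<in> mspace X" for x y
    using that Wd[OF qCin qCin] cong[of x y "q x" "q y"] q by simp
  have cont: "continuous_map (mtopology_of X) (mtopology_of W) q"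
    unfolding continuous_map_def
  proof (intro conjI allI impI)
    show "q \<in> topspace (mtopology_of X) \<rightarrow> topspace (mtopology_of W)" using qCin by (simp add: WC)
    fix U assume U: "openin (mtopology_of W) U"
    have "\<exists>r>0. \<forall>y\<in>mspace X. mdist X x y < r \<longrightarrow> q y \<in> U" if x: "x \<in> mspace X" "q x \<in> U" for x
    proof -
      obtain r where r: "r > 0" "\<forall>w\<in>mspace W. mdist W (q x) w < r \<longrightarrow> w \<in> U"
        using U x(2) unfolding openin_mtopology_of by blast
      obtain \<delta> where \<delta>: "\<delta> > 0" "\<And>y. y \<in> mspace X \<Longrightarrow> mdist X x y < \<delta> \<Longrightarrow> D x y < r"
        using invariant_pseudometric_continuous[OF D x(1) r(1)] by blast
      have "q y \<in> U" if "y \<in> mspace X" "mdist X x y < \<delta>" for y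
        using r(2) \<delta>(2)[OF that] qd[OF x(1) that(1)] qCin[OF that(1)] by (simp add: WC)
      then show ?thesis using \<delta>(1) by blast
    qed
    then show "openin (mtopology_of X) {x \<in> topspace (mtopology_of X). q x \<in> U}"
      unfolding openin_mtopology_of by auto
  qed
  have im: "q ` mspace X = mspace W" by (simp add: WC C_def)
  have cpt: "compact_space (mtopology_of W)"
    using image_compactin[OF _ cont, of "mspace X"] X im
    by (simp add: dyn_system_def compact_space_def)
  have Tin: "T x \<in> mspace X" if "x \<in> mspace X" for x using dyn_system_in[OF X that] .
  have qT: "q (T x) = R (q x)" if x: "x \<in> mspace X" for x
    unfolding R_def comp_def using q_eq[OF Tin[OF x] Tin[OF q(1)[OF x]]] inv[OF x q(1)[OF x]] q(2)[OF x] by simp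
  have iso: "mdist W (R a) (R b) = mdist W a b" if "a \<in> mspace W" "b \<in> mspace W" for a b
  proof -
    have ab: "a \<in> mspace X" "b \<in> mspace X" "q a = a" "q b = b" using that Cin qC by (auto simp: WC)
    have "mdist W (R a) (R b) = D (T a) (T b)" using qd[OF Tin Tin] ab by (simp add: R_def)
    also have "\<dots> = mdist W a b" using inv[OF ab(1,2)] qd[OF ab(1,2)] ab(3,4) by simp
    finally show ?thesis .
  qed
  have Rim: "R ` mspace W = mspace W"
  proof
    show "R ` mspace W \<subseteq> mspace W" using Cin Tin qCin by (auto simp: WC R_def)
    show "mspace W \<subseteq> R ` mspace W"
    proof
      fix w assume "w \<in> mspace W"
      then obtain x where x: "x \<in> mspace X" "w = q x" using im by blast
      obtain x' where "x' \<in> mspace X" "x = T x'"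
        using x(1) dyn_system_bij_betw[OF X] by (metis bij_betw_def imageE)
      then show "w \<in> R ` mspace W" using x qT qCin by (auto simp: WC)
    qed
  qed
  have "Lipschitz_continuous_map W W R"
    unfolding Lipschitz_continuous_map_def using Rim iso by (auto intro!: exI[of _ 1])
  then have "continuous_map (mtopology_of W) (mtopology_of W) R"
    by (rule Lipschitz_continuous_imp_continuous_map)
  \<comment> \<open>An isometry is injective, and a continuous bijection of a compact Hausdorff
    space is a homeomorphism.\<close>
  moreover have "inj_on R (mspace W)"
    using iso mdist_zero unfolding inj_on_def by metis
  ultimately have "homeomorphic_map (mtopology_of W) (mtopology_of W) R"
    using cpt Rim by (intro continuous_imp_homeomorphic_map) (auto simp: Hausdorff_space_mtopology_of)
  then have sysW: "dyn_system W R" using cpt by (simp add: dyn_system_def)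
  show ?thesis
  proof (rule that)
    show "equicontinuous_system W R" using sysW iso by (rule isometric_equicontinuous)
    show "factor_map X T W R q"
      unfolding factor_map_def using X sysW cont im qT by blast
  qed (rule qd)
qed

text \<open>The quotient by \<open>D\<close> is an equicontinuous factor with carrier in the type of
  \<open>X\<close>, so the universal property applies and its factor map is constant on the fibres
  of \<open>p\<close>.\<close>

lemma max_equicontinuous_factor_pseudometric:
  assumes E: "max_equicontinuous_factor X T E U p" and D: "invariant_pseudometric X T D"
    and x: "x \<in> mspace X" "y \<in> mspace X" "p x = p y"
  shows "D x y = 0"
proof -
  have X: "dyn_system X T" using E by (simp add: max_equicontinuous_factor_def factor_map_def)
  obtain W :: "'a metric" and R q where W: "equicontinuous_system W R" "factor_map X T W R q"
    and d: "\<And>x y. x \<in> mspace X \<Longrightarrow> y \<in> mspace X \<Longrightarrow> mdist W (q x) (q y) = D x y"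
    using quotient_by_pseudometric[OF X D] by metis
  obtain r where "\<And>x. x \<in> mspace X \<Longrightarrow> q x = r (p x)"
    using E W unfolding max_equicontinuous_factor_def by blast
  then have "q x = q y" using x by simp
  moreover have "D x x = 0" using invariant_pseudometric_zero[OF D x(1)] .
  ultimately show ?thesis using d[OF x(1,2)] d[OF x(1,1)] by simp
qed

text \<open>The supremum over all times of the distance between the images of two orbits is
  invariant, and equicontinuity of \<open>W\<close> makes it continuous.\<close>

lemma equicontinuous_factor_pseudometric:
  assumes W: "equicontinuous_system W R" and q: "factor_map X T W R q"
  obtains D where "invariant_pseudometric X T D"
    "\<And>x y. x \<in> mspace X \<Longrightarrow> y \<in> mspace X \<Longrightarrow> D x y = 0 \<Longrightarrow> q x = q y"
proof -
  have X: "dyn_system X T" and sysW: "dyn_system W R" and qin: "\<And>x. x \<in> mspace X \<Longrightarrow> q x \<in> mspace W"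
    and cont: "continuous_map (mtopology_of X) (mtopology_of W) q"
    using q by (auto simp: factor_map_def)
  define f where "f n x = q (int_iter X T n x)" for n x
  have fW: "f n x = int_iter W R n (q x)" if "x \<in> mspace X" for n x
    unfolding f_def using factor_map_int_iter[OF q that] .
  have fin: "f n x \<in> mspace W" if "x \<in> mspace X" for n x
    unfolding f_def using qin int_iter_in[OF X that] by blast
  define D where "D x y = (SUP n. mdist W (f n x) (f n y))" for x y
  \<comment> \<open>Compactness bounds the distances in \<open>W\<close>, so that the supremum over
    all times is meaningful.\<close>
  obtain B where B: "\<And>a b. a \<in> mspace W \<Longrightarrow> b \<in> mspace W \<Longrightarrow> mdist W a b \<le> B"
  proof -
    have "compactin (mtopology_of W) (mspace W)"
      using sysW by (simp add: dyn_system_def compact_space_def)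
    then have "Metric_space.mbounded (mspace W) (mdist W) (mspace W)"
      by (simp add: mtopology_of_def Metric_space.compactin_imp_mbounded)
    then show ?thesis using that
      by (auto simp: Metric_space.mbounded_alt[OF Metric_space_mspace_mdist])
  qed
  have bdd: "bdd_above (range (\<lambda>n. mdist W (f n x) (f n y)))" if "x \<in> mspace X" "y \<in> mspace X" for x y
    using B fin that by (intro bdd_aboveI[of _ B]) auto
  have upper: "mdist W (f n x) (f n y) \<le> D x y" if "x \<in> mspace X" "y \<in> mspace X" for n x y
    unfolding D_def by (rule cSUP_upper[OF UNIV_I bdd[OF that]])
  have least: "D x y \<le> c" if "\<And>n. mdist W (f n x) (f n y) \<le> c" for x y c
    unfolding D_def by (rule cSUP_least) (use that in auto)
  have "invariant_pseudometric X T D"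
    unfolding invariant_pseudometric_def
  proof (intro conjI ballI allI impI)
    fix x assume x: "x \<in> mspace X"
    show "D x x = 0" unfolding D_def using fin[OF x] by (simp add: mdist_self)
    fix y assume y: "y \<in> mspace X"
    show "D x y = D y x" unfolding D_def by (simp add: mdist_commute)
    show "D (T x) (T y) = D x y"
    proof (rule antisym)
      show "D (T x) (T y) \<le> D x y"
      proof (rule least)
        fix n
        show "mdist W (f n (T x)) (f n (T y)) \<le> D x y"
          using upper[OF x y, of "n + 1"] by (simp add: f_def int_iter_shift[OF X] x y)
      qed
      \<comment> \<open>Time \<open>n\<close> of the original orbits is time \<open>n - 1\<close> of
        the shifted ones; this is available because the supremum runs over all integers.\<close>
      show "D x y \<le> D (T x) (T y)"
      proof (rule least)
        fix n
        show "mdist W (f n x) (f n y) \<le> D (T x) (T y)"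
          using upper[OF dyn_system_in[OF X x] dyn_system_in[OF X y], of "n - 1"]
          by (simp add: f_def int_iter_shift[OF X] x y)
      qed
    qed
    fix z assume z: "z \<in> mspace X"
    show "D x z \<le> D x y + D y z"
    proof (rule least)
      fix n
      have "mdist W (f n x) (f n z) \<le> mdist W (f n x) (f n y) + mdist W (f n y) (f n z)"
        by (intro mdist_triangle fin x y z)
      also have "\<dots> \<le> D x y + D y z" by (intro add_mono upper x y z)
      finally show "mdist W (f n x) (f n z) \<le> D x y + D y z" .
    qed
  next
    fix x and \<epsilon> :: real assume x: "x \<in> mspace X" and "\<epsilon> > 0"
    \<comment> \<open>Half of \<open>\<epsilon>\<close> leaves room for the supremum, which
      preserves only non-strict bounds.\<close>
    then obtain \<delta> where \<delta>: "\<delta> > 0" "\<And>a b n. a \<in> mspace W \<Longrightarrow> b \<in> mspace W \<Longrightarrow>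
        mdist W a b < \<delta> \<Longrightarrow> mdist W (int_iter W R n a) (int_iter W R n b) < \<epsilon> / 2"
      using W unfolding equicontinuous_system_def by (metis half_gt_zero)
    have "openin (mtopology_of X) {y \<in> topspace (mtopology_of X). q y \<in> {w \<in> mspace W. mdist W (q x) w < \<delta>}}"
      by (rule openin_continuous_map_preimage[OF cont openin_mdist_ball[OF qin[OF x]]])
    moreover have "x \<in> {y \<in> topspace (mtopology_of X). q y \<in> {w \<in> mspace W. mdist W (q x) w < \<delta>}}"
      using x qin[OF x] \<delta>(1) by (simp add: mdist_self)
    ultimately obtain r where r: "r > 0"
      "\<forall>y\<in>mspace X. mdist X x y < r \<longrightarrow> mdist W (q x) (q y) < \<delta>"
      unfolding openin_mtopology_of by (metis (no_types, lifting) mem_Collect_eq topspace_mtopology_of)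
    have "D x y < \<epsilon>" if y: "y \<in> mspace X" "mdist X x y < r" for y
    proof -
      have "D x y \<le> \<epsilon> / 2"
        using \<delta>(2)[OF qin[OF x] qin[OF y(1)]] r(2) y fW x by (intro least) (simp add: less_imp_le)
      then show ?thesis using \<open>\<epsilon> > 0\<close> by simp
    qed
    then show "\<exists>\<delta>>0. \<forall>y\<in>mspace X. mdist X x y < \<delta> \<longrightarrow> D x y < \<epsilon>" using r(1) by blast
  qed
  moreover have "q x = q y" if xy: "x \<in> mspace X" "y \<in> mspace X" "D x y = 0" for x y
  proof -
    have "mdist W (q x) (q y) \<le> 0" using upper[OF xy(1,2), of 0] xy(3) by (simp add: f_def)
    then show ?thesis using qin xy(1,2) by (metis mdist_nonneg mdist_zero order_antisym)
  qed
  ultimately show ?thesis by (rule that)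
qed

section \<open>Existence of the maximal equicontinuous factor\<close>

text \<open>A continuous surjection from a compact space onto a Hausdorff space is a quotient map,
  so a map constant on its fibres descends continuously.\<close>

lemma factor_map_lift:
  assumes p: "factor_map X T E U p" and q: "factor_map X T W R q"
    and pq: "\<And>x y. x \<in> mspace X \<Longrightarrow> y \<in> mspace X \<Longrightarrow> p x = p y \<Longrightarrow> q x = q y"
  obtains r where "factor_map E U W R r" "\<And>x. x \<in> mspace X \<Longrightarrow> q x = r (p x)"
proof -
  have X: "dyn_system X T" and cp: "continuous_map (mtopology_of X) (mtopology_of E) p"
    and imp: "p ` mspace X = mspace E" and cq: "continuous_map (mtopology_of X) (mtopology_of W) q"
    and imq: "q ` mspace X = mspace W" and pT: "\<And>x. x \<in> mspace X \<Longrightarrow> p (T x) = U (p x)"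
    and qT: "\<And>x. x \<in> mspace X \<Longrightarrow> q (T x) = R (q x)"
    using p q by (auto simp: factor_map_def)
  have "quotient_map (mtopology_of X) (mtopology_of E) p"
    using X cp imp by (intro continuous_imp_quotient_map)
      (auto simp: dyn_system_def Hausdorff_space_mtopology_of)
  then obtain r where r: "continuous_map (mtopology_of E) (mtopology_of W) r"
    "r ` mspace E = q ` mspace X" "\<And>x. x \<in> mspace X \<Longrightarrow> r (p x) = q x"
    using quotient_map_lift_exists[OF _ cq] pq by (metis topspace_mtopology_of)
  have "r (U e) = R (r e)" if e: "e \<in> mspace E" for e
  proof -
    obtain x where x: "x \<in> mspace X" "e = p x" using e imp by blast
    have "r (U e) = r (p (T x))" using pT[OF x(1)] x(2) by simp
    also have "\<dots> = q (T x)" by (rule r(3)[OF dyn_system_in[OF X x(1)]])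
    also have "\<dots> = R (r e)" using qT[OF x(1)] r(3)[OF x(1)] x(2) by simp
    finally show ?thesis .
  qed
  then have "factor_map E U W R r"
    using p q r imq unfolding factor_map_def by simp
  then show ?thesis using that r(3) by simp
qed

text \<open>
  A maximal equicontinuous factor is the quotient by a single invariant pseudometric that vanishes
  only where all of them do. Countably many suffice, one for each pair of small balls around the
  points of finite nets on which some invariant pseudometric is positive.
\<close>

lemma max_equicontinuous_factor_exists:
  fixes X :: "'a metric"
  assumes X: "dyn_system X T"
  obtains E :: "'a metric" and U p where "max_equicontinuous_factor X T E U p"
proof -
  have "\<exists>K. finite K \<and> K \<subseteq> mspace X \<and> (\<forall>x\<in>mspace X. \<exists>a\<in>K. mdist X a x < 1 / real (Suc n))" for n
    using compact_metric_finite_net[of X "1 / real (Suc n)"] X by (metis dyn_system_def of_nat_0_less_iff zero_less_Suc zero_less_divide_1_iff)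
  then obtain K where K: "\<And>n. finite (K n)"
    "\<And>n. K n \<subseteq> mspace X" "\<And>n x. x \<in> mspace X \<Longrightarrow> \<exists>a\<in>K n. mdist X a x < 1 / real (Suc n)"
    by metis
  define P where "P = (\<lambda>(n, a, b) D. invariant_pseudometric X T D \<and> (\<forall>x\<in>mspace X. \<forall>y\<in>mspace X.
      mdist X a x < 1 / real (Suc n) \<and> mdist X b y < 1 / real (Suc n) \<longrightarrow> D x y > 0))"
  define I where "I = (SIGMA n:UNIV. K n \<times> K n)"
  have "countable I"
    unfolding I_def using K(1) by (intro countable_SIGMA) (auto intro: countable_finite)
  define Z where "Z = (\<lambda>(x::'a) (y::'a). 0::real)"
  have Z: "invariant_pseudometric X T Z"
    by (auto simp: Z_def invariant_pseudometric_def intro: exI[of _ 1])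
  \<comment> \<open>The zero pseudometric \<open>Z\<close> is the default for pairs of balls that no
    invariant pseudometric separates, so every \<open>e i\<close> is an invariant
    pseudometric.\<close>
  define e where "e i = (if \<exists>D. P i D then SOME D. P i D else Z)" for i
  have eP: "P i (e i)" if "P i D" for i D
    using someI[of "P i" D] that by (auto simp: e_def)
  have e: "invariant_pseudometric X T (e i)" for i
    using eP[of i] Z by (cases "\<exists>D. P i D") (auto simp: P_def e_def split: prod.splits)
  \<comment> \<open>Truncation at \<open>1\<close> keeps the triangle inequality, and the weights
    tend to zero, so near a given point only finitely many indices have to be controlled.\<close>
  define t where "t k x y = (1/2) ^ k * min 1 (e (from_nat_into I k) x y)" for k x y
  note nn = invariant_pseudometric_nonneg[OF e] and tri = invariant_pseudometric_triangle[OF e]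
  have t0: "0 \<le> t k x y" "t k x y \<le> (1/2) ^ k" if "x \<in> mspace X" "y \<in> mspace X" for k x y
    using nn[OF that] by (auto simp: t_def mult_left_le)
  have t1: "t k x y \<le> 1" if "x \<in> mspace X" "y \<in> mspace X" for k x y
    using t0(2)[OF that, of k] power_le_one[of "1/2::real" k] by linarith
  have ttri: "t k x z \<le> t k x y + t k y z" if "x \<in> mspace X" "y \<in> mspace X" "z \<in> mspace X" for k x y z
  proof -
    have "min 1 (e i x z) \<le> min 1 (e i x y) + min 1 (e i y z)" for i
      using tri[OF that, of i] nn[OF that(1,2), of i] nn[OF that(2,3), of i] by linarith
    then show ?thesis unfolding t_def
      by (metis (no_types, lifting) distrib_left mult_left_mono zero_le_power zero_le_divide_1_iff zero_le_numeral)
  qed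
  define D where "D x y = (SUP k. t k x y)" for x y
  have upper: "t k x y \<le> D x y" if "x \<in> mspace X" "y \<in> mspace X" for k x y
    unfolding D_def by (rule cSUP_upper) (use t1[OF that] in \<open>auto intro!: bdd_aboveI[of _ 1]\<close>)
  have least: "D x y \<le> c" if "\<And>k. t k x y \<le> c" for x y c
    unfolding D_def by (rule cSUP_least) (use that in auto)
  have D: "invariant_pseudometric X T D"
    unfolding invariant_pseudometric_def
  proof (intro conjI ballI allI impI)
    fix x assume x: "x \<in> mspace X"
    show "D x x = 0" unfolding D_def t_def using invariant_pseudometric_zero[OF e x] by simp
    fix y assume y: "y \<in> mspace X"
    show "D x y = D y x" unfolding D_def t_def using invariant_pseudometric_sym[OF e x y] by simp
    show "D (T x) (T y) = D x y" unfolding D_def t_def using invariant_pseudometric_invariant[OF e x y] by simp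
    fix z assume z: "z \<in> mspace X"
    show "D x z \<le> D x y + D y z"
    proof (rule least)
      fix k
      show "t k x z \<le> D x y + D y z"
        using ttri[OF x y z, of k] upper[OF x y, of k] upper[OF y z, of k] by linarith
    qed
  next
    fix x and \<epsilon> :: real assume x: "x \<in> mspace X" and \<epsilon>: "\<epsilon> > 0"
    obtain N where N: "(1/2::real) ^ N < \<epsilon> / 2"
      using real_arch_pow_inv[of "\<epsilon> / 2" "1/2"] \<epsilon> by auto
    have "\<exists>\<delta>>0. \<forall>y\<in>mspace X. mdist X x y < \<delta> \<longrightarrow> t k x y < \<epsilon> / 2" for k
    proof -
      obtain \<delta> where \<delta>: "\<delta> > 0" "\<And>y. y \<in> mspace X \<Longrightarrow> mdist X x y < \<delta> \<Longrightarrow> e (from_nat_into I k) x y < \<epsilon> / 2"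
        using invariant_pseudometric_continuous[OF e x, of "\<epsilon> / 2"] \<epsilon> by (metis half_gt_zero)
      have "t k x y < \<epsilon> / 2" if "y \<in> mspace X" "mdist X x y < \<delta>" for y
      proof -
        have "t k x y \<le> 1 * min 1 (e (from_nat_into I k) x y)"
          unfolding t_def using nn[OF x that(1)] by (intro mult_right_mono) (auto simp: power_le_one)
        also have "\<dots> < \<epsilon> / 2" using \<delta>(2)[OF that] by simp
        finally show ?thesis .
      qed
      then show ?thesis using \<delta>(1) by blast
    qed
    then obtain \<delta> where \<delta>: "\<And>k. \<delta> k > 0"
      "\<And>k y. y \<in> mspace X \<Longrightarrow> mdist X x y < \<delta> k \<Longrightarrow> t k x y < \<epsilon> / 2" by metis
    define d where "d = Min (\<delta> ` {..N})"
    have "d > 0" using \<delta>(1) by (simp add: d_def)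
    moreover have "D x y < \<epsilon>" if y: "y \<in> mspace X" "mdist X x y < d" for y
    proof -
      have "t k x y \<le> \<epsilon> / 2" for k
      proof (cases "k \<le> N")
        case True
        then have "d \<le> \<delta> k" by (simp add: d_def)
        then show ?thesis using \<delta>(2)[of y k] y by simp
      next
        case False
        then have "(1/2::real) ^ k \<le> (1/2) ^ N" by (intro power_decreasing) auto
        then show ?thesis using t0(2)[OF x y(1), of k] N by linarith
      qed
      then have "D x y \<le> \<epsilon> / 2" by (rule least)
      then show ?thesis using \<epsilon> by simp
    qed
    ultimately show "\<exists>\<delta>>0. \<forall>y\<in>mspace X. mdist X x y < \<delta> \<longrightarrow> D x y < \<epsilon>" by blast
  qed
  \<comment> \<open>If \<open>D' x y > 0\<close>, then \<open>D'\<close> stays positive on a pair of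
    net balls containing \<open>x\<close> and \<open>y\<close>. The pseudometric chosen for that
    pair is therefore also positive at \<open>x\<close> and \<open>y\<close>, and it contributes to
    \<open>D\<close>.\<close>
  have Dmax: "D' x y = 0" if D': "invariant_pseudometric X T D'" and xy: "x \<in> mspace X" "y \<in> mspace X"
    and 0: "D x y = 0" for D' x y
  proof (rule ccontr)
    assume "D' x y \<noteq> 0"
    then have c: "D' x y > 0" using invariant_pseudometric_nonneg[OF D' xy] by simp
    define c where "c = D' x y / 2"
    have "c > 0" using c by (simp add: c_def)
    obtain d1 where d1: "d1 > 0" "\<And>z. z \<in> mspace X \<Longrightarrow> mdist X x z < d1 \<Longrightarrow> D' x z < c"
      using invariant_pseudometric_continuous[OF D' xy(1) \<open>c > 0\<close>] by blast
    obtain d2 where d2: "d2 > 0" "\<And>z. z \<in> mspace X \<Longrightarrow> mdist X y z < d2 \<Longrightarrow> D' y z < c"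
      using invariant_pseudometric_continuous[OF D' xy(2) \<open>c > 0\<close>] by blast
    \<comment> \<open>With \<open>1 / real (Suc n)\<close> below half of both radii, any two points
      of one net ball are closer than \<open>d1\<close> and \<open>d2\<close>.\<close>
    obtain n where n: "1 / real (Suc n) < min d1 d2 / 2"
      using reals_Archimedean[of "min d1 d2 / 2"] d1(1) d2(1) by (auto simp: inverse_eq_divide)
    obtain a b where a: "a \<in> K n" "mdist X a x < 1 / real (Suc n)" and b: "b \<in> K n" "mdist X b y < 1 / real (Suc n)"
      using K(3)[OF xy(1)] K(3)[OF xy(2)] by blast
    have abX: "a \<in> mspace X" "b \<in> mspace X" using a b K(2) by auto
    have "P (n, a, b) D'"
      unfolding P_def prod.case
    proof (intro conjI D' ballI impI)
      fix u v assume uv: "u \<in> mspace X" "v \<in> mspace X"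
        "mdist X a u < 1 / real (Suc n) \<and> mdist X b v < 1 / real (Suc n)"
      have "mdist X x u < d1"
        using mdist_triangle[OF xy(1) abX(1) uv(1)] a(2) uv(3) n by (simp add: mdist_commute)
      moreover have "mdist X y v < d2"
        using mdist_triangle[OF xy(2) abX(2) uv(2)] b(2) uv(3) n by (simp add: mdist_commute)
      ultimately have "D' x u < c" "D' y v < c" using d1 d2 uv by auto
      moreover have "D' x y \<le> D' x u + D' u v + D' y v"
        using invariant_pseudometric_triangle[OF D' xy(1) uv(1) xy(2)] invariant_pseudometric_triangle[OF D' uv(1,2) xy(2)] invariant_pseudometric_sym[OF D' uv(2) xy(2)]
        by simp
      ultimately show "D' u v > 0" by (simp add: c_def)
    qed
    then have "P (n, a, b) (e (n, a, b))" by (rule eP)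
    then have pos: "e (n, a, b) x y > 0" using a b xy by (auto simp: P_def)
    have "(n, a, b) \<in> I" using a b by (simp add: I_def)
    then obtain k where "from_nat_into I k = (n, a, b)"
      using \<open>countable I\<close> by (metis from_nat_into_surj)
    then have "t k x y > 0" using pos by (simp add: t_def)
    then show False using upper[OF xy, of k] 0 by simp
  qed
  obtain E :: "'a metric" and U p where E: "equicontinuous_system E U" "factor_map X T E U p"
    and d: "\<And>x y. x \<in> mspace X \<Longrightarrow> y \<in> mspace X \<Longrightarrow> mdist E (p x) (p y) = D x y"
    using quotient_by_pseudometric[OF X D] by metis
  have "max_equicontinuous_factor X T E U p"
    unfolding max_equicontinuous_factor_def
  proof (intro conjI E allI impI)
    fix W :: "'a metric" and R q
    assume "equicontinuous_system W R \<and> factor_map X T W R q"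
    then have W: "equicontinuous_system W R" and q: "factor_map X T W R q" by auto
    obtain D' where D': "invariant_pseudometric X T D'"
      "\<And>x y. x \<in> mspace X \<Longrightarrow> y \<in> mspace X \<Longrightarrow> D' x y = 0 \<Longrightarrow> q x = q y"
      using equicontinuous_factor_pseudometric[OF W q] by blast
    have "q x = q y" if xy: "x \<in> mspace X" "y \<in> mspace X" "p x = p y" for x y
      using d[OF xy(1,2)] d[OF xy(1,1)] xy(3) invariant_pseudometric_zero[OF D xy(1)] Dmax[OF D'(1) xy(1,2)] D'(2)[OF xy(1,2)]
      by simp
    from factor_map_lift[OF E(2) q this]
    show "\<exists>r. factor_map E U W R r \<and> (\<forall>x\<in>mspace X. q x = r (p x))" by metis
  qed
  then show ?thesis by (rule that)
qed

subsection \<open>Sections of closed invariant sets\<close>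

text \<open>The mean is a cluster point of the counting averages over initial segments, in the
  compact cube of all functions from sets of naturals to the unit interval.\<close>

lemma shift_invariant_mean:
  obtains \<nu> :: "nat set \<Rightarrow> real" where "\<And>A. 0 \<le> \<nu> A" "\<nu> UNIV = 1"
    "\<And>A B. A \<inter> B = {} \<Longrightarrow> \<nu> (A \<union> B) = \<nu> A + \<nu> B" "\<And>A. \<nu> {n. Suc n \<in> A} = \<nu> A"
proof -
  define Pr where "Pr = product_topology (\<lambda>_::nat set. top_of_set {0..1::real}) UNIV"
  define a where "a n A = real (card (A \<inter> {..n})) / real (Suc n)" for n and A :: "nat set"
  have a01: "a n A \<in> {0..1}" for n A
    using card_mono[of "{..n}" "A \<inter> {..n}"] by (simp add: a_def)
  have top: "topspace Pr = {f. \<forall>A. f A \<in> {0..1}}" by (auto simp: Pr_def)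
  have aPr: "a n \<in> topspace Pr" for n using a01 by (auto simp: top)
  have cpt: "compact_space Pr"
    unfolding Pr_def compact_space_product_topology by (simp add: compact_space_subtopology)
  \<comment> \<open>The average with the largest index in \<open>F\<close> lies in all these tails;
    inserting \<open>0\<close> covers an empty \<open>F\<close>.\<close>
  have fip: "(\<Inter>N\<in>F. Pr closure_of (a ` {N..})) \<noteq> {}" if F: "finite F" for F :: "nat set"
  proof -
    have "a (Max (insert 0 F)) \<in> Pr closure_of (a ` {N..})" if "N \<in> F" for N
    proof -
      have "N \<le> Max (insert 0 F)" using F that by simp
      then have "a (Max (insert 0 F)) \<in> a ` {N..}" by blast
      then show ?thesis using closure_of_subset[of "a ` {N..}" Pr] aPr by auto
    qed
    then show ?thesis by blast
  qed
  have "\<Inter>(range (\<lambda>N. Pr closure_of (a ` {N..}))) \<noteq> {}"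
  proof (rule cpt[unfolded compact_space_fip, rule_format], intro conjI ballI allI impI)
    fix \<F> assume "finite \<F> \<and> \<F> \<subseteq> range (\<lambda>N. Pr closure_of (a ` {N..}))"
    then obtain F where "finite F" "\<F> = (\<lambda>N. Pr closure_of (a ` {N..})) ` F"
      using finite_subset_image[of \<F> "\<lambda>N. Pr closure_of (a ` {N..})" UNIV] by auto
    then show "\<Inter>\<F> \<noteq> {}" using fip by simp
  qed auto
  then obtain \<nu> where \<nu>: "\<And>N. \<nu> \<in> Pr closure_of (a ` {N..})" by blast
  \<comment> \<open>A closed condition on a continuous function of the averages that holds from some
    index on passes to \<open>\<nu>\<close>. All properties of \<open>\<nu>\<close> are obtained
    this way.\<close>
  have lim: "h \<nu> \<in> C" if h: "continuous_map Pr euclidean h" and C: "closed C"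
      and ev: "\<And>n. n \<ge> N \<Longrightarrow> h (a n) \<in> C" for h :: "_ \<Rightarrow> real" and C N
  proof -
    have "closedin Pr {f \<in> topspace Pr. h f \<in> C}"
      using closedin_continuous_map_preimage[OF h] C by simp
    moreover have "a ` {N..} \<subseteq> {f \<in> topspace Pr. h f \<in> C}" using ev aPr by auto
    ultimately show ?thesis using \<nu>[of N] closure_of_minimal by blast
  qed
  have proj: "continuous_map Pr euclidean (\<lambda>f. f A)" for A
    using continuous_map_product_projection[of A UNIV "\<lambda>_::nat set. top_of_set {0..1::real}"]
    by (simp add: Pr_def continuous_map_in_subtopology)
  show ?thesis
  proof (rule that[of \<nu>])
    show "0 \<le> \<nu> A" for A
      using lim[OF proj, of "{0..}" 0 A] a01 by simp
    have "a n UNIV = 1" for n by (simp add: a_def)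
    then show "\<nu> UNIV = 1"
      using lim[OF proj, of "{1}" 0 UNIV] by simp
    show "\<nu> (A \<union> B) = \<nu> A + \<nu> B" if "A \<inter> B = {}" for A B
    proof -
      have "a n (A \<union> B) - (a n A + a n B) = 0" for n
      proof -
        have "card ((A \<union> B) \<inter> {..n}) = card (A \<inter> {..n}) + card (B \<inter> {..n})"
          using that by (subst card_Un_disjoint[symmetric]) (auto simp: Int_Un_distrib2)
        then show ?thesis by (simp add: a_def add_divide_distrib)
      qed
      moreover have "continuous_map Pr euclidean (\<lambda>f. f (A \<union> B) - (f A + f B))"
        by (intro continuous_map_diff continuous_map_add proj)
      ultimately show ?thesis using lim[of "\<lambda>f. f (A \<union> B) - (f A + f B)" "{0}" 0] by simp
    qed
    show "\<nu> {n. Suc n \<in> A} = \<nu> A" for A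
    proof -
      define B where "B = {n. Suc n \<in> A}"
      \<comment> \<open>Shifting a set changes its count in an initial segment by at most one, at
        one of the two ends.\<close>
      have step: "\<bar>a n B - a n A\<bar> \<le> 1 / real (Suc n)" for n
      proof -
        have "Suc ` (B \<inter> {..n}) \<subseteq> insert (Suc n) (A \<inter> {..n})" by (auto simp: B_def)
        then have "card (Suc ` (B \<inter> {..n})) \<le> card (insert (Suc n) (A \<inter> {..n}))"
          by (intro card_mono) auto
        then have 1: "card (B \<inter> {..n}) \<le> Suc (card (A \<inter> {..n}))"
          by (simp add: card_image)
        have "A \<inter> {..n} \<subseteq> insert 0 (Suc ` (B \<inter> {..n}))"
        proof
          fix k assume "k \<in> A \<inter> {..n}"
          then show "k \<in> insert 0 (Suc ` (B \<inter> {..n}))" by (cases k) (auto simp: B_def)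
        qed
        then have "card (A \<inter> {..n}) \<le> card (insert 0 (Suc ` (B \<inter> {..n})))"
          by (intro card_mono) auto
        also have "\<dots> \<le> Suc (card (B \<inter> {..n}))"
          using card_insert_le_m1 by (simp add: card_insert_if card_image)
        finally have "card (A \<inter> {..n}) \<le> Suc (card (B \<inter> {..n}))" .
        with 1 have "\<bar>real (card (B \<inter> {..n})) - real (card (A \<inter> {..n}))\<bar> \<le> 1" by linarith
        then show ?thesis
          unfolding a_def diff_divide_distrib[symmetric] abs_divide by (simp add: divide_right_mono)
      qed
      have "\<bar>\<nu> B - \<nu> A\<bar> \<le> 1 / real (Suc N)" for N
      proof -
        have "\<nu> B - \<nu> A \<in> {- (1 / real (Suc N))..1 / real (Suc N)}"
        proof (rule lim[of "\<lambda>f. f B - f A"])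
          show "continuous_map Pr euclidean (\<lambda>f. f B - f A)"
            by (intro continuous_map_diff proj)
          fix n assume "n \<ge> N"
          then have "1 / real (Suc n) \<le> 1 / real (Suc N)" by (simp add: frac_le)
          then have "\<bar>a n B - a n A\<bar> \<le> 1 / real (Suc N)" using step[of n] by linarith
          then show "a n B - a n A \<in> {- (1 / real (Suc N))..1 / real (Suc N)}" by (simp add: abs_le_iff)
        qed simp
        then show ?thesis by (simp add: abs_le_iff)
      qed
      then have "\<bar>\<nu> B - \<nu> A\<bar> \<le> 0"
        using reals_Archimedean[of "\<bar>\<nu> B - \<nu> A\<bar>"] by (metis inverse_eq_divide leD leI)
      then show ?thesis by (simp add: B_def)
    qed
  qed
qed

text \<open>These properties of the outer measure of a fully supported invariant probability measure are
  all that is needed to make the measure of a symmetric difference into a pseudometric.\<close>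

definition invariant_outer_content :: "'c metric \<Rightarrow> ('c \<Rightarrow> 'c) \<Rightarrow> ('c set \<Rightarrow> real) \<Rightarrow> bool" where
  "invariant_outer_content Z S m \<longleftrightarrow>
     (\<forall>A B. A \<subseteq> B \<and> B \<subseteq> mspace Z \<longrightarrow> m A \<le> m B) \<and>
     (\<forall>A B. A \<subseteq> mspace Z \<and> B \<subseteq> mspace Z \<longrightarrow> m (A \<union> B) + m (A \<inter> B) \<le> m A + m B) \<and>
     (\<forall>A. A \<subseteq> mspace Z \<longrightarrow> m (S ` A) = m A) \<and>
     (\<forall>A e. A \<subseteq> mspace Z \<and> e > 0 \<longrightarrow> (\<exists>U. openin (mtopology_of Z) U \<and> A \<subseteq> U \<and> m U < m A + e)) \<and>
     (\<forall>A V. A \<subseteq> mspace Z \<and> openin (mtopology_of Z) V \<and> V \<noteq> {} \<and> A \<inter> V = {} \<longrightarrow> m A < m (A \<union> V))"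

text \<open>The mean of the visiting times of one orbit is an invariant, finitely additive function
  \<open>l\<close> of all subsets. Taking the infimum of \<open>l\<close> over open supersets adds
  outer regularity and keeps submodularity; no countable additivity is involved.\<close>

lemma minimal_outer_content:
  fixes Z :: "'c metric"
  assumes Z: "minimal_system Z S" and ne: "mspace Z \<noteq> {}"
  obtains m where "invariant_outer_content Z S m"
proof -
  have sys: "dyn_system Z S" using Z by (rule minimal_system_dyn)
  have inj: "inj_on S (mspace Z)" using dyn_system_bij_betw[OF sys] by (rule bij_betw_imp_inj_on)
  obtain z0 where z0: "z0 \<in> mspace Z" using ne by blast
  obtain \<nu> :: "nat set \<Rightarrow> real" where \<nu>: "\<And>A. 0 \<le> \<nu> A" "\<nu> UNIV = 1"
    "\<And>A B. A \<inter> B = {} \<Longrightarrow> \<nu> (A \<union> B) = \<nu> A + \<nu> B" "\<And>A. \<nu> {n. Suc n \<in> A} = \<nu> A"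
    using shift_invariant_mean by metis
  define l where "l A = \<nu> {n. (S ^^ n) z0 \<in> A}" for A
  have l0: "0 \<le> l A" for A using \<nu>(1) by (simp add: l_def)
  have lspace: "l (mspace Z) = 1" using \<nu>(2) funpow_in[OF sys z0] by (simp add: l_def)
  have ladd: "l (A \<union> B) = l A + l B" if "A \<inter> B = {}" for A B
    unfolding l_def using \<nu>(3)[of "{n. (S ^^ n) z0 \<in> A}" "{n. (S ^^ n) z0 \<in> B}"] that
    by (simp add: disjoint_iff Collect_disj_eq)
  have lmono: "l A \<le> l B" if "A \<subseteq> B" for A B
    using ladd[of A "B - A"] l0[of "B - A"] that by (simp add: Un_absorb1)
  have lmod: "l (A \<union> B) + l (A \<inter> B) = l A + l B" for A B
  proof -
    have "A \<union> B = A \<union> (B - A)" "B = (A \<inter> B) \<union> (B - A)" by auto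
    then show ?thesis
      using ladd[of A "B - A"] ladd[of "A \<inter> B" "B - A"] by (simp add: disjoint_iff)
  qed
  have linv: "l (S ` A) = l A" if A: "A \<subseteq> mspace Z" for A
  proof -
    \<comment> \<open>By injectivity, the orbit visits the image of \<open>A\<close> at time
      \<open>n + 1\<close> exactly when it visits \<open>A\<close> at time \<open>n\<close>, so
      invariance of \<open>l\<close> is shift invariance of the mean.\<close>
    have "S ((S ^^ n) z0) \<in> S ` A \<longleftrightarrow> (S ^^ n) z0 \<in> A" for n
      using inj_on_image_mem_iff[OF inj funpow_in[OF sys z0] A] .
    then show ?thesis
      unfolding l_def using \<nu>(4)[of "{n. (S ^^ n) z0 \<in> S ` A}"] by simp
  qed
  \<comment> \<open>Full support: finitely many preimages of \<open>U\<close> cover the space, and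
    none of them has more mass than \<open>U\<close>.\<close>
  have lpos: "0 < l U" if U: "openin (mtopology_of Z) U" "U \<noteq> {}" for U
  proof -
    obtain K where K: "\<And>x. x \<in> mspace Z \<Longrightarrow> \<exists>j\<le>K. (S ^^ j) x \<in> U"
      using minimal_bounded_return[OF Z U] by metis
    define P where "P j = {x \<in> mspace Z. (S ^^ j) x \<in> U}" for j
    have P: "l (P j) \<le> l U" for j
    proof -
      have "l ((S ^^ i) ` P j) = l (P j) \<and> (S ^^ i) ` P j \<subseteq> mspace Z" for i
      proof (induction i)
        case 0
        then show ?case by (auto simp: P_def)
      next
        case (Suc i)
        have "(S ^^ Suc i) ` P j = S ` (S ^^ i) ` P j" by (simp add: image_comp)
        then show ?case using linv[of "(S ^^ i) ` P j"] Suc dyn_system_in[OF sys] by auto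
      qed
      moreover have "(S ^^ j) ` P j \<subseteq> U" by (auto simp: P_def)
      ultimately show ?thesis using lmono by metis
    qed
    have "l (\<Union>j\<le>k. P j) \<le> real (Suc k) * l U" for k
    proof (induction k)
      case 0
      then show ?case using P[of 0] by simp
    next
      case (Suc k)
      have "l (\<Union>j\<le>Suc k. P j) \<le> l (\<Union>j\<le>k. P j) + l (P (Suc k))"
        using lmod[of "\<Union>j\<le>k. P j" "P (Suc k)"] l0[of "(\<Union>j\<le>k. P j) \<inter> P (Suc k)"]
        by (simp add: atMost_Suc Un_commute)
      then show ?case using Suc P[of "Suc k"] by (simp add: algebra_simps)
    qed
    from this[of K] have "1 \<le> real (Suc K) * l U"
      using lmono[of "mspace Z" "\<Union>j\<le>K. P j"] K lspace by (force simp: P_def)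
    then have "0 < real (Suc K) * l U" by linarith
    then show ?thesis by (simp add: zero_less_mult_iff)
  qed
  define Op where "Op A = {U. openin (mtopology_of Z) U \<and> A \<subseteq> U}" for A
  define m where "m A = (INF U\<in>Op A. l U)" for A
  have bdd: "bdd_below (l ` Op A)" for A using l0 by (intro bdd_belowI[of _ 0]) auto
  have ne': "Op A \<noteq> {}" if "A \<subseteq> mspace Z" for A
    using that openin_topspace[of "mtopology_of Z"] by (auto simp: Op_def)
  have lower: "m A \<le> l U" if "U \<in> Op A" for U A
    unfolding m_def by (rule cINF_lower[OF bdd that])
  have greatest: "c \<le> m A" if "A \<subseteq> mspace Z" "\<And>U. U \<in> Op A \<Longrightarrow> c \<le> l U" for A c
    unfolding m_def by (rule cINF_greatest) (use ne' that in auto)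
  have approx: "\<exists>U\<in>Op A. l U < m A + e" if "A \<subseteq> mspace Z" "e > 0" for A and e :: real
    using greatest[of A "m A + e"] that by force
  have mopen: "m U = l U" if U: "openin (mtopology_of Z) U" for U
  proof (rule antisym)
    show "m U \<le> l U" using U by (intro lower) (simp add: Op_def)
    show "l U \<le> m U"
      using openin_subset[OF U] by (intro greatest lmono) (auto simp: Op_def)
  qed
  have minv_le: "m (S ` A) \<le> m A" if A: "A \<subseteq> mspace Z" for A
  proof (rule greatest[OF A])
    fix U assume U: "U \<in> Op A"
    then have "openin (mtopology_of Z) (S ` U)"
      using sys homeomorphic_imp_open_map unfolding dyn_system_def open_map_def Op_def by blast
    then have "S ` U \<in> Op (S ` A)" using U by (auto simp: Op_def)
    then have "m (S ` A) \<le> l (S ` U)" by (rule lower)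
    also have "\<dots> = l U" using U openin_subset by (intro linv) (fastforce simp: Op_def)
    finally show "m (S ` A) \<le> l U" .
  qed
  have minv_ge: "m A \<le> m (S ` A)" if A: "A \<subseteq> mspace Z" for A
  proof (rule greatest)
    show "S ` A \<subseteq> mspace Z" using A dyn_system_in[OF sys] by auto
    fix U assume U: "U \<in> Op (S ` A)"
    define U' where "U' = {z \<in> mspace Z. S z \<in> U}"
    have "continuous_map (mtopology_of Z) (mtopology_of Z) S"
      using sys homeomorphic_imp_continuous_map unfolding dyn_system_def by blast
    then have "openin (mtopology_of Z) U'"
      using openin_continuous_map_preimage[of "mtopology_of Z" "mtopology_of Z" S U] U
      by (simp add: Op_def U'_def)
    then have "U' \<in> Op A" using A U by (auto simp: Op_def U'_def)
    then have "m A \<le> l U'" by (rule lower)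
    also have "\<dots> = l (S ` U')" by (rule linv[symmetric]) (auto simp: U'_def)
    also have "\<dots> \<le> l U" by (rule lmono) (auto simp: U'_def)
    finally show "m A \<le> l U" .
  qed
  have mono: "m A \<le> m B" if "A \<subseteq> B" "B \<subseteq> mspace Z" for A B
    using that(2) by (rule greatest) (use that(1) in \<open>auto intro!: lower simp: Op_def\<close>)
  have submod: "m (A \<union> B) + m (A \<inter> B) \<le> m A + m B" if AB: "A \<subseteq> mspace Z" "B \<subseteq> mspace Z" for A B
  proof (rule field_le_epsilon)
    fix e :: real assume "e > 0"
    obtain U where U: "U \<in> Op A" "l U < m A + e / 2" using approx[OF AB(1), of "e / 2"] \<open>e > 0\<close> by auto
    obtain V where V: "V \<in> Op B" "l V < m B + e / 2" using approx[OF AB(2), of "e / 2"] \<open>e > 0\<close> by auto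
    have "m (A \<union> B) \<le> l (U \<union> V)" "m (A \<inter> B) \<le> l (U \<inter> V)"
      using U(1) V(1) by (auto intro!: lower simp: Op_def)
    then show "m (A \<union> B) + m (A \<inter> B) \<le> m A + m B + e" using lmod[of U V] U(2) V(2) by simp
  qed
  have minv: "m (S ` A) = m A" if "A \<subseteq> mspace Z" for A
    using minv_le[OF that] minv_ge[OF that] by simp
  have outer: "\<exists>U. openin (mtopology_of Z) U \<and> A \<subseteq> U \<and> m U < m A + e" if "A \<subseteq> mspace Z" "e > 0" for A and e :: real
    using approx[OF that] mopen by (auto simp: Op_def)
  have strict: "m A < m (A \<union> V)"
    if A: "A \<subseteq> mspace Z" and V: "openin (mtopology_of Z) V" "V \<noteq> {}" and dj: "A \<inter> V = {}" for A V
  proof -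
    obtain v where v: "v \<in> V" using V by blast
    then have vZ: "v \<in> mspace Z" using openin_subset[OF V(1)] by auto
    obtain r where r: "r > 0" "\<forall>y\<in>mspace Z. mdist Z v y < r \<longrightarrow> y \<in> V"
      using V(1) v unfolding openin_mtopology_of by meson
    \<comment> \<open>Removing the closed ball \<open>C\<close> from an open superset of
      \<open>A\<close> and \<open>V\<close> leaves an open superset of \<open>A\<close>, and the
      removed part contains the open ball \<open>B\<close> of positive mass.\<close>
    define B where "B = {y \<in> mspace Z. mdist Z v y < r / 2}"
    define C where "C = {y \<in> mspace Z. mdist Z v y \<le> r / 2}"
    have B: "openin (mtopology_of Z) B" unfolding B_def using vZ by (rule openin_mdist_ball)
    have C: "closedin (mtopology_of Z) C" unfolding C_def using vZ by (rule closedin_mdist_cball)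
    have "v \<in> B" using vZ r(1) by (simp add: B_def mdist_self)
    then have "0 < l B" using lpos[OF B] by blast
    moreover have "m A + l B \<le> m (A \<union> V)"
    proof (rule greatest)
      show "A \<union> V \<subseteq> mspace Z" using A openin_subset[OF V(1)] by auto
      fix U assume U: "U \<in> Op (A \<union> V)"
      have CV: "C \<subseteq> V" using r by (auto simp: C_def)
      have "U - C \<in> Op A" using U C dj CV by (auto simp: Op_def)
      then have "m A \<le> l (U - C)" by (rule lower)
      moreover have "l (U - C) + l B = l ((U - C) \<union> B)"
        by (rule ladd[symmetric]) (auto simp: B_def C_def)
      moreover have "l ((U - C) \<union> B) \<le> l U"
      proof (rule lmono)
        have "B \<subseteq> C" by (auto simp: B_def C_def)
        then show "(U - C) \<union> B \<subseteq> U" using U CV by (auto simp: Op_def)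
      qed
      ultimately show "m A + l B \<le> l U" by simp
    qed
    ultimately show ?thesis by simp
  qed
  have "invariant_outer_content Z S m"
    unfolding invariant_outer_content_def
    by (intro conjI allI impI; (elim conjE)?) (rule mono submod minv outer strict; assumption)+
  then show ?thesis by (rule that)
qed

section \<open>The content of sections as a pseudometric\<close>

text \<open>The content of the sections of \<open>N\<close> is upper semicontinuous and invariant,
  hence constant by minimality. The excess content of the union of two sections is then a
  pseudometric, and its vanishing transfers open pieces from one section to the other by full
  support.\<close>

lemma section_pseudometric:
  fixes X :: "'a metric" and Z :: "'c metric"
  assumes X: "minimal_system X T" and Z: "minimal_system Z S" and ne: "mspace Z \<noteq> {}"
    and N: "closedin (prod_topology (mtopology_of X) (mtopology_of Z)) N" and inv: "map_prod T S ` N = N"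
  obtains D where "invariant_pseudometric X T D"
    "\<And>x y V. x \<in> mspace X \<Longrightarrow> y \<in> mspace X \<Longrightarrow> D x y = 0 \<Longrightarrow> openin (mtopology_of Z) V \<Longrightarrow>
       {x} \<times> V \<subseteq> N \<Longrightarrow> {y} \<times> V \<subseteq> N"
proof -
  have sysX: "dyn_system X T" and sysZ: "dyn_system Z S" using X Z by (auto simp: minimal_system_dyn)
  have NXZ: "N \<subseteq> mspace X \<times> mspace Z" using closedin_subset[OF N] by simp
  obtain m where m: "invariant_outer_content Z S m"
    using minimal_outer_content[OF Z ne] by blast
  have mono: "m A \<le> m B" if "A \<subseteq> B" "B \<subseteq> mspace Z" for A B
    using m that by (simp add: invariant_outer_content_def)
  have submod: "m (A \<union> B) + m (A \<inter> B) \<le> m A + m B" if "A \<subseteq> mspace Z" "B \<subseteq> mspace Z" for A B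
    using m that by (simp add: invariant_outer_content_def)
  have minv: "m (S ` A) = m A" if "A \<subseteq> mspace Z" for A
    using m that by (simp add: invariant_outer_content_def)
  have outer: "\<exists>U. openin (mtopology_of Z) U \<and> A \<subseteq> U \<and> m U < m A + e"
    if "A \<subseteq> mspace Z" "e > 0" for A e
    using m that by (simp add: invariant_outer_content_def)
  have strict: "m A < m (A \<union> V)"
    if "A \<subseteq> mspace Z" "openin (mtopology_of Z) V" "V \<noteq> {}" "A \<inter> V = {}" for A V
    using m that by (simp add: invariant_outer_content_def)
  define f where "f x = {z. (x, z) \<in> N}" for x
  have fZ: "f x \<subseteq> mspace Z" for x using NXZ by (auto simp: f_def)
  have fcl: "closedin (mtopology_of Z) (f x)" if x: "x \<in> mspace X" for x
  proof -
    have "continuous_map (mtopology_of Z) (prod_topology (mtopology_of X) (mtopology_of Z)) (\<lambda>z. (x, z))"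
      using x by (simp add: continuous_map_pairedI)
    from closedin_continuous_map_preimage[OF this N]
    have "closedin (mtopology_of Z) {z \<in> mspace Z. (x, z) \<in> N}" by simp
    moreover have "{z \<in> mspace Z. (x, z) \<in> N} = f x" using fZ[of x] by (auto simp: f_def)
    ultimately show ?thesis by simp
  qed
  have fT: "f (T x) = S ` f x" if x: "x \<in> mspace X" for x
  proof
    show "S ` f x \<subseteq> f (T x)"
    proof
      fix w assume "w \<in> S ` f x"
      then obtain z where "(x, z) \<in> N" "w = S z" by (auto simp: f_def)
      then have "map_prod T S (x, z) \<in> N" using inv by blast
      then show "w \<in> f (T x)" using \<open>w = S z\<close> by (simp add: f_def)
    qed
    show "f (T x) \<subseteq> S ` f x"
    proof
      fix w assume "w \<in> f (T x)"
      then have "(T x, w) \<in> map_prod T S ` N" using inv by (simp add: f_def)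
      then obtain a b where ab: "(a, b) \<in> N" "T x = T a" "w = S b" by auto
      then have "a = x"
        using NXZ x bij_betw_imp_inj_on[OF dyn_system_bij_betw[OF sysX]] by (auto simp: inj_on_def)
      then show "w \<in> S ` f x" using ab by (auto simp: f_def)
    qed
  qed
  \<comment> \<open>Upper semicontinuity of the sections: the projection along the compact space
    \<open>Z\<close> is a closed map.\<close>
  have fop: "openin (mtopology_of X) {x \<in> mspace X. f x \<subseteq> U}" if U: "openin (mtopology_of Z) U" for U
  proof -
    have "closedin (prod_topology (mtopology_of X) (mtopology_of Z)) (N \<inter> (mspace X \<times> (mspace Z - U)))"
    proof (rule closedin_Int[OF N])
      have "closedin (mtopology_of Z) (mspace Z - U)" "closedin (mtopology_of X) (mspace X)"
        using closedin_diff[OF closedin_topspace U] closedin_topspace[of "mtopology_of X"] by simp_all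
      then show "closedin (prod_topology (mtopology_of X) (mtopology_of Z)) (mspace X \<times> (mspace Z - U))"
        by (simp add: closedin_prod_Times_iff)
    qed
    then have "closedin (mtopology_of X) (fst ` (N \<inter> (mspace X \<times> (mspace Z - U))))"
      using closed_map_fst[of "mtopology_of Z" "mtopology_of X"] sysZ
      unfolding dyn_system_def closed_map_def by blast
    moreover have "mspace X - fst ` (N \<inter> (mspace X \<times> (mspace Z - U))) = {x \<in> mspace X. f x \<subseteq> U}"
      using NXZ by (force simp: f_def)
    ultimately show ?thesis by (metis closedin_def topspace_mtopology_of)
  qed
  have const: "m (f x) \<ge> m (f y)" if xy: "x \<in> mspace X" "y \<in> mspace X" for x y
  proof -
    \<comment> \<open>This superlevel set is closed by outer regularity and upper semicontinuity, is
      invariant, and contains \<open>y\<close>.\<close>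
    define A where "A = {w \<in> mspace X. m (f w) \<ge> m (f y)}"
    have "openin (mtopology_of X) (mspace X - A)"
      unfolding openin_subopen[of _ "mspace X - A"]
    proof
      fix w assume "w \<in> mspace X - A"
      then have w: "w \<in> mspace X" "m (f w) < m (f y)" by (auto simp: A_def)
      then obtain U where U: "openin (mtopology_of Z) U" "f w \<subseteq> U" "m U < m (f y)"
        using outer[OF fZ[of w], of "m (f y) - m (f w)"] by auto
      have "{x \<in> mspace X. f x \<subseteq> U} \<subseteq> mspace X - A"
      proof
        fix v assume "v \<in> {x \<in> mspace X. f x \<subseteq> U}"
        then show "v \<in> mspace X - A"
          using mono[of "f v" U] openin_subset[OF U(1)] U(3) by (simp add: A_def)
      qed
      then show "\<exists>P. openin (mtopology_of X) P \<and> w \<in> P \<and> P \<subseteq> mspace X - A"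
        using fop[OF U(1)] w U(2) by blast
    qed
    then have "closedin (mtopology_of X) A" by (auto simp: closedin_def A_def)
    moreover have "T ` A \<subseteq> A" using fT minv[OF fZ] dyn_system_in[OF sysX] by (auto simp: A_def)
    moreover have "A \<noteq> {}" using xy by (auto simp: A_def)
    ultimately have "A = mspace X" by (rule minimal_closed_invariant[OF X])
    then show ?thesis using xy by (auto simp: A_def)
  qed
  then have const: "m (f x) = m (f y)" if "x \<in> mspace X" "y \<in> mspace X" for x y
    using that by (simp add: order_antisym)
  \<comment> \<open>For a measure and sections of equal mass, this is half the measure of their
    symmetric difference.\<close>
  define D where "D x y = m (f x \<union> f y) - m (f x)" for x y
  show ?thesis
  proof (rule that[of D])
    show "invariant_pseudometric X T D"
      unfolding invariant_pseudometric_def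
    proof (intro conjI ballI allI impI)
      fix x assume x: "x \<in> mspace X"
      show "D x x = 0" by (simp add: D_def)
      fix y assume y: "y \<in> mspace X"
      show "D x y = D y x" using const[OF x y] by (simp add: D_def Un_commute)
      show "D (T x) (T y) = D x y"
        using fT x y minv[OF fZ[of x]] minv[of "f x \<union> f y"] fZ by (simp add: D_def image_Un)
      fix z assume z: "z \<in> mspace X"
      \<comment> \<open>The triangle inequality is submodularity for the unions
        \<open>f x \<union> f y\<close> and \<open>f y \<union> f z\<close>, whose intersection
        contains \<open>f y\<close>.\<close>
      have "m (f x \<union> f z) \<le> m ((f x \<union> f y) \<union> (f y \<union> f z))" "m (f y) \<le> m ((f x \<union> f y) \<inter> (f y \<union> f z))"
        using fZ by (auto intro!: mono)
      then have "m (f x \<union> f z) + m (f y) \<le> m (f x \<union> f y) + m (f y \<union> f z)"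
        using submod[of "f x \<union> f y" "f y \<union> f z"] fZ by auto
      then show "D x z \<le> D x y + D y z" by (simp add: D_def)
    next
      fix x and \<epsilon> :: real assume x: "x \<in> mspace X" and "\<epsilon> > 0"
      then obtain U where U: "openin (mtopology_of Z) U" "f x \<subseteq> U" "m U < m (f x) + \<epsilon>"
        using outer[OF fZ] by meson
      obtain r where r: "r > 0" "\<forall>y\<in>mspace X. mdist X x y < r \<longrightarrow> y \<in> {x \<in> mspace X. f x \<subseteq> U}"
        using fop[OF U(1)] x U(2) unfolding openin_mtopology_of by blast
      have "D x y < \<epsilon>" if "y \<in> mspace X" "mdist X x y < r" for y
      proof -
        have "m (f x \<union> f y) \<le> m U" using U(2) r(2) that openin_subset[OF U(1)] by (intro mono) auto
        then show ?thesis using U(3) by (simp add: D_def)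
      qed
      then show "\<exists>\<delta>>0. \<forall>y\<in>mspace X. mdist X x y < \<delta> \<longrightarrow> D x y < \<epsilon>" using r(1) by blast
    qed
    fix x y V
    assume xy: "x \<in> mspace X" "y \<in> mspace X" and D0: "D x y = 0" and V: "openin (mtopology_of Z) V"
      and VN: "{x} \<times> V \<subseteq> N"
    have "V - f y = {}"
    proof (rule ccontr)
      assume "V - f y \<noteq> {}"
      then have "m (f y) < m (f y \<union> (V - f y))"
        \<comment> \<open>Since \<open>f y\<close> is closed, \<open>V - f y\<close> is open, so
          adding it to \<open>f y\<close> would strictly increase the content.\<close>
        using strict[OF fZ[of y] openin_diff[OF V fcl[OF xy(2)]]] by blast
      also have "\<dots> \<le> m (f x \<union> f y)" using VN fZ by (intro mono) (auto simp: f_def)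
      finally show False using D0 const[OF xy] by (simp add: D_def)
    qed
    then show "{y} \<times> V \<subseteq> N" by (auto simp: f_def)
  qed
qed

lemma section_depends_on_equicontinuous_factor:
  assumes "minimal_system X T" "minimal_system Z S"
    and "closedin (prod_topology (mtopology_of X) (mtopology_of Z)) N" "map_prod T S ` N = N"
    and "max_equicontinuous_factor X T E U p"
    and "x \<in> mspace X" "y \<in> mspace X" "p x = p y" "openin (mtopology_of Z) V" "{x} \<times> V \<subseteq> N"
  shows "{y} \<times> V \<subseteq> N"
proof (cases "mspace Z = {}")
  case True
  then show ?thesis using openin_subset[OF assms(9)] by auto
next
  case False
  obtain D where "invariant_pseudometric X T D"
    "\<And>x y V. x \<in> mspace X \<Longrightarrow> y \<in> mspace X \<Longrightarrow> D x y = 0 \<Longrightarrow> openin (mtopology_of Z) V \<Longrightarrow>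
       {x} \<times> V \<subseteq> N \<Longrightarrow> {y} \<times> V \<subseteq> N"
    using section_pseudometric[OF assms(1,2) False assms(3,4)] by metis
  then show ?thesis
    using max_equicontinuous_factor_pseudometric[OF assms(5) _ assms(6-8)] assms(6,7,9,10) by metis
qed

text \<open>The preceding lemma with the two coordinates exchanged.\<close>

lemma section_depends_on_equicontinuous_factor':
  assumes "minimal_system X T" "minimal_system Z S"
    and N: "closedin (prod_topology (mtopology_of X) (mtopology_of Z)) N" "map_prod T S ` N = N"
    and "max_equicontinuous_factor Z S E U p"
    and "z \<in> mspace Z" "w \<in> mspace Z" "p z = p w" "openin (mtopology_of X) V" "V \<times> {z} \<subseteq> N"
  shows "V \<times> {w} \<subseteq> N"
proof -
  let ?N = "prod.swap ` N"
  have "closedin (prod_topology (mtopology_of Z) (mtopology_of X)) ?N"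
  proof -
    have "closed_map (prod_topology (mtopology_of X) (mtopology_of Z))
        (prod_topology (mtopology_of Z) (mtopology_of X)) (\<lambda>(x, y). (y, x))"
      by (rule homeomorphic_imp_closed_map[OF homeomorphic_map_swap])
    moreover have "(\<lambda>(x, y). (y, x)) ` N = ?N" by (simp add: prod.swap_def case_prod_beta')
    ultimately show ?thesis using N(1) unfolding closed_map_def by metis
  qed
  moreover have "map_prod S T ` ?N = ?N"
  proof -
    have "map_prod S T ` ?N = prod.swap ` map_prod T S ` N" unfolding image_image by (auto intro!: image_cong)
    then show ?thesis using N(2) by simp
  qed
  moreover have "{z} \<times> V \<subseteq> ?N" using assms(10) by force
  ultimately have "{w} \<times> V \<subseteq> ?N"
    using section_depends_on_equicontinuous_factor[OF assms(2,1) _ _ assms(5-9)] by blast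
  then show ?thesis by auto
qed

subsection \<open>Products of systems\<close>

abbreviation prod_mtopology :: "'a metric \<Rightarrow> 'b metric \<Rightarrow> ('a \<times> 'b) topology" where
  "prod_mtopology X Z \<equiv> prod_topology (mtopology_of X) (mtopology_of Z)"

lemma continuous_map_map_prod:
  assumes "continuous_map X X' f" "continuous_map Y Y' g"
  shows "continuous_map (prod_topology X Y) (prod_topology X' Y') (map_prod f g)"
  using assms by (simp add: map_prod_def continuous_map_prod_top)

lemma compact_prod_mtopology:
  "dyn_system X T \<Longrightarrow> dyn_system Z S \<Longrightarrow> compact_space (prod_mtopology X Z)"
  by (simp add: dyn_system_def compact_space_prod_topology)

lemma Hausdorff_prod_mtopology: "Hausdorff_space (prod_mtopology X Z)"
  by (simp add: Hausdorff_space_prod_topology Hausdorff_space_mtopology_of)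

lemma factor_map_continuous: "factor_map X T Y S p \<Longrightarrow> continuous_map (mtopology_of X) (mtopology_of Y) p"
  and factor_map_in: "factor_map X T Y S p \<Longrightarrow> x \<in> mspace X \<Longrightarrow> p x \<in> mspace Y"
  and factor_map_dyn: "factor_map X T Y S p \<Longrightarrow> dyn_system X T" "factor_map X T Y S p \<Longrightarrow> dyn_system Y S"
  and factor_map_image: "factor_map X T Y S p \<Longrightarrow> p ` mspace X = mspace Y"
  and factor_map_commute: "factor_map X T Y S p \<Longrightarrow> x \<in> mspace X \<Longrightarrow> p (T x) = S (p x)"
  by (auto simp: factor_map_def)

lemma factor_map_surj:
  assumes "factor_map X T Y S p" "y \<in> mspace Y"
  obtains x where "x \<in> mspace X" "p x = y"
  using assms factor_map_image by (metis imageE)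

lemma factor_map_compose:
  assumes p: "factor_map X T Y S p" and q: "factor_map Y S W R q"
  shows "factor_map X T W R (q \<circ> p)"
  unfolding factor_map_def
proof (intro conjI ballI)
  show "dyn_system X T" "dyn_system W R" using factor_map_dyn[OF p] factor_map_dyn[OF q] by auto
  show "continuous_map (mtopology_of X) (mtopology_of W) (q \<circ> p)"
    using factor_map_continuous[OF p] factor_map_continuous[OF q] by (rule continuous_map_compose)
  show "(q \<circ> p) ` mspace X = mspace W"
    unfolding image_comp[symmetric] factor_map_image[OF p] by (rule factor_map_image[OF q])
  show "(q \<circ> p) (T x) = R ((q \<circ> p) x)" if "x \<in> mspace X" for x
    using factor_map_commute[OF p that] factor_map_commute[OF q factor_map_in[OF p that]] by simp
qed

lemma factor_map_id: "dyn_system X T \<Longrightarrow> factor_map X T X T id"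
  by (simp add: factor_map_def)

lemma closedin_map_prod_factor:
  assumes p: "factor_map X T Y T' p" and q: "factor_map Z S W R q" and J: "closedin (prod_mtopology X Z) J"
  shows "closedin (prod_mtopology Y W) (map_prod p q ` J)"
proof -
  have "closed_map (prod_mtopology X Z) (prod_mtopology Y W) (map_prod p q)"
    using factor_map_continuous[OF p] factor_map_continuous[OF q] factor_map_dyn[OF p] factor_map_dyn[OF q]
    by (intro continuous_imp_closed_map continuous_map_map_prod)
      (auto intro: compact_prod_mtopology Hausdorff_prod_mtopology)
  then show ?thesis using J by (simp add: closed_map_def)
qed

lemma map_prod_factor_invariant:
  assumes p: "factor_map X T Y T' p" and q: "factor_map Z S W R q"
    and J: "J \<subseteq> mspace X \<times> mspace Z" "map_prod T S ` J = J"
  shows "map_prod T' R ` map_prod p q ` J = map_prod p q ` J"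
proof -
  have "map_prod T' R ` map_prod p q ` J = map_prod p q ` map_prod T S ` J"
    unfolding image_image
  proof (rule image_cong[OF refl])
    fix w assume "w \<in> J"
    then have "fst w \<in> mspace X" "snd w \<in> mspace Z" using J by auto
    then show "map_prod T' R (map_prod p q w) = map_prod p q (map_prod T S w)"
      using factor_map_commute[OF p] factor_map_commute[OF q] by (simp add: prod_eq_iff)
  qed
  then show ?thesis using J by simp
qed

text \<open>Forward times use that the image of \<open>A\<close> lies in \<open>A\<close>; backward
  times use the reverse inclusion and injectivity of \<open>T\<close> and \<open>S\<close>.\<close>

lemma prod_int_iter_invariant:
  assumes X: "dyn_system X T" and Z: "dyn_system Z S"
    and A: "A \<subseteq> mspace X \<times> mspace Z" "map_prod T S ` A = A" and a: "(x, z) \<in> A"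
  shows "(int_iter X T n x, int_iter Z S n z) \<in> A"
proof (induction n rule: int_induct[where k = 0])
  case base
  show ?case using a by simp
next
  case (step1 i)
  have xz: "x \<in> mspace X" "z \<in> mspace Z" using A a by auto
  have "map_prod T S (int_iter X T i x, int_iter Z S i z) \<in> A"
    using step1 A(2) by (metis imageI)
  then show ?case using int_iter_Suc[OF X xz(1), of i] int_iter_Suc[OF Z xz(2), of i] by simp
next
  case (step2 i)
  have xz: "x \<in> mspace X" "z \<in> mspace Z" using A a by auto
  obtain u v where uv: "(u, v) \<in> A" "int_iter X T i x = T u" "int_iter Z S i z = S v"
  proof -
    have "(int_iter X T i x, int_iter Z S i z) \<in> map_prod T S ` A" using step2 A(2) by simp
    then show ?thesis using that by auto
  qed
  have "T u = T (int_iter X T (i - 1) x)" "S v = S (int_iter Z S (i - 1) z)"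
    using uv int_iter_Suc[OF X xz(1), of "i - 1"] int_iter_Suc[OF Z xz(2), of "i - 1"] by simp_all
  moreover have "u \<in> mspace X" "v \<in> mspace Z" using uv A by auto
  ultimately have "u = int_iter X T (i - 1) x" "v = int_iter Z S (i - 1) z"
    using bij_betw_imp_inj_on[OF dyn_system_bij_betw[OF X]] bij_betw_imp_inj_on[OF dyn_system_bij_betw[OF Z]]
      int_iter_in[OF X xz(1)] int_iter_in[OF Z xz(2)] by (simp_all add: inj_on_def)
  with uv show ?case by simp
qed

lemma map_prod_image_eqI:
  assumes X: "dyn_system X T" and Z: "dyn_system Z S" and A: "A \<subseteq> mspace X \<times> mspace Z"
    and step: "\<And>n x z. (x, z) \<in> A \<Longrightarrow> (int_iter X T n x, int_iter Z S n z) \<in> A"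
  shows "map_prod T S ` A = A"
proof
  have T1: "int_iter X T 1 x = T x" for x by (simp add: int_iter_def)
  have S1: "int_iter Z S 1 z = S z" for z by (simp add: int_iter_def)
  show "map_prod T S ` A \<subseteq> A" using step[of _ _ 1] by (auto simp: T1 S1)
  show "A \<subseteq> map_prod T S ` A"
  proof
    fix w assume w: "w \<in> A"
    obtain x z where xz: "w = (x, z)" by (cases w)
    have "x \<in> mspace X" "z \<in> mspace Z" using A w xz by auto
    then have "w = map_prod T S (int_iter X T (- 1) x, int_iter Z S (- 1) z)"
      using int_iter_inverse(1)[OF X, of x 1] int_iter_inverse(1)[OF Z, of z 1] by (simp add: T1 S1 xz)
    moreover have "(int_iter X T (- 1) x, int_iter Z S (- 1) z) \<in> A" using step w xz by simp
    ultimately show "w \<in> map_prod T S ` A" by (rule image_eqI)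
  qed
qed

lemma closure_of_prod_invariant:
  assumes X: "dyn_system X T" and Z: "dyn_system Z S"
    and A: "A \<subseteq> mspace X \<times> mspace Z" "map_prod T S ` A = A"
  shows "map_prod T S ` (prod_mtopology X Z closure_of A) = prod_mtopology X Z closure_of A"
proof (rule map_prod_image_eqI[OF X Z])
  show "prod_mtopology X Z closure_of A \<subseteq> mspace X \<times> mspace Z"
    using closure_of_subset_topspace[of "prod_mtopology X Z" A] by simp
  fix n x z assume w: "(x, z) \<in> prod_mtopology X Z closure_of A"
  let ?f = "map_prod (int_iter X T n) (int_iter Z S n)"
  have "continuous_map (prod_mtopology X Z) (prod_mtopology X Z) ?f"
    by (intro continuous_map_map_prod homeomorphic_imp_continuous_map homeomorphic_map_int_iter X Z)
  then have "?f ` (prod_mtopology X Z closure_of A) \<subseteq> prod_mtopology X Z closure_of (?f ` A)"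
    by (rule continuous_map_image_closure_subset)
  moreover have "?f ` A \<subseteq> A" using prod_int_iter_invariant[OF X Z A] by auto
  ultimately have "?f (x, z) \<in> prod_mtopology X Z closure_of A"
    using w closure_of_mono[of "?f ` A" A "prod_mtopology X Z"] by blast
  then show "(int_iter X T n x, int_iter Z S n z) \<in> prod_mtopology X Z closure_of A" by simp
qed

section \<open>Saturated boxes and fibre neighbourhoods\<close>

definition orbit_saturation ::
    "'a metric \<Rightarrow> ('a \<Rightarrow> 'a) \<Rightarrow> 'b metric \<Rightarrow> ('b \<Rightarrow> 'b) \<Rightarrow> 'a set \<Rightarrow> 'b set \<Rightarrow> ('a \<times> 'b) set" where
  "orbit_saturation X T Z S A B =
     {(x, z). x \<in> mspace X \<and> z \<in> mspace Z \<and> (\<exists>n. int_iter X T n x \<in> A \<and> int_iter Z S n z \<in> B)}"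

lemma orbit_saturation_subset: "orbit_saturation X T Z S A B \<subseteq> mspace X \<times> mspace Z"
  by (auto simp: orbit_saturation_def)

lemma openin_orbit_saturation:
  assumes X: "dyn_system X T" and Z: "dyn_system Z S"
    and A: "openin (mtopology_of X) A" and B: "openin (mtopology_of Z) B"
  shows "openin (prod_mtopology X Z) (orbit_saturation X T Z S A B)"
proof -
  have "orbit_saturation X T Z S A B =
      (\<Union>n. {x \<in> mspace X. int_iter X T n x \<in> A} \<times> {z \<in> mspace Z. int_iter Z S n z \<in> B})"
    by (auto simp: orbit_saturation_def)
  moreover have "openin (mtopology_of X) {x \<in> mspace X. int_iter X T n x \<in> A}" for n
    using openin_continuous_map_preimage[OF homeomorphic_imp_continuous_map[OF homeomorphic_map_int_iter[OF X]] A]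
    by simp
  moreover have "openin (mtopology_of Z) {z \<in> mspace Z. int_iter Z S n z \<in> B}" for n
    using openin_continuous_map_preimage[OF homeomorphic_imp_continuous_map[OF homeomorphic_map_int_iter[OF Z]] B]
    by simp
  ultimately show ?thesis by (auto simp: openin_prod_Times_iff)
qed

lemma orbit_saturation_int_iter:
  assumes X: "dyn_system X T" and Z: "dyn_system Z S" and x: "x \<in> mspace X" and z: "z \<in> mspace Z"
  shows "(int_iter X T m x, int_iter Z S m z) \<in> orbit_saturation X T Z S A B
    \<longleftrightarrow> (x, z) \<in> orbit_saturation X T Z S A B"
proof
  assume "(int_iter X T m x, int_iter Z S m z) \<in> orbit_saturation X T Z S A B"
  then obtain n where "int_iter X T n (int_iter X T m x) \<in> A" "int_iter Z S n (int_iter Z S m z) \<in> B"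
    by (auto simp: orbit_saturation_def)
  then have "int_iter X T (n + m) x \<in> A" "int_iter Z S (n + m) z \<in> B"
    by (simp_all add: int_iter_add[OF X x] int_iter_add[OF Z z])
  then show "(x, z) \<in> orbit_saturation X T Z S A B" using x z by (auto simp: orbit_saturation_def)
next
  assume "(x, z) \<in> orbit_saturation X T Z S A B"
  then obtain n where "int_iter X T n x \<in> A" "int_iter Z S n z \<in> B"
    by (auto simp: orbit_saturation_def)
  then have "int_iter X T (n - m) (int_iter X T m x) \<in> A" "int_iter Z S (n - m) (int_iter Z S m z) \<in> B"
    using int_iter_add[OF X x, of "n - m" m] int_iter_add[OF Z z, of "n - m" m] by simp_all
  then show "(int_iter X T m x, int_iter Z S m z) \<in> orbit_saturation X T Z S A B"
    using int_iter_in[OF X x] int_iter_in[OF Z z] by (auto simp: orbit_saturation_def)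
qed

text \<open>Bounding the distance at all times makes the set invariant, and the non-strict bound
  makes it closed. Membership of \<open>x'\<close> in the carrier comes from
  \<open>J\<close>.\<close>

definition fibre_neighbourhood ::
    "'a metric \<Rightarrow> ('a \<Rightarrow> 'a) \<Rightarrow> ('a \<Rightarrow> 'b) \<Rightarrow> ('a \<times> 'c) set \<Rightarrow> real \<Rightarrow> ('a \<times> 'c) set" where
  "fibre_neighbourhood X T p J \<epsilon> = {(x, z). x \<in> mspace X \<and> (\<exists>x'. p x' = p x \<and> (x', z) \<in> J \<and>
      (\<forall>n. mdist X (int_iter X T n x) (int_iter X T n x') \<le> \<epsilon>))}"

text \<open>The set is the image, under forgetting \<open>x'\<close>, of a closed set of triples
  \<open>(x, x', z)\<close> in a compact product.\<close>

lemma fibre_neighbourhood_closed_invariant: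
  assumes p: "factor_map X T Y T' p" and Z: "dyn_system Z S"
    and J: "closedin (prod_mtopology X Z) J" "map_prod T S ` J = J"
  shows "closedin (prod_mtopology X Z) (fibre_neighbourhood X T p J \<epsilon>)"
    and "map_prod T S ` fibre_neighbourhood X T p J \<epsilon> = fibre_neighbourhood X T p J \<epsilon>"
proof -
  have X: "dyn_system X T" using factor_map_dyn[OF p] by simp
  have JXZ: "J \<subseteq> mspace X \<times> mspace Z" using closedin_subset[OF J(1)] by simp
  define N where "N = fibre_neighbourhood X T p J \<epsilon>"
  note N_def = N_def[unfolded fibre_neighbourhood_def]
  let ?P = "prod_topology (mtopology_of X) (prod_mtopology X Z)"
  have c1: "continuous_map ?P (mtopology_of X) fst" by (rule continuous_map_fst)
  have c2: "continuous_map ?P (mtopology_of X) (\<lambda>w. fst (snd w))"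
    using continuous_map_compose[OF continuous_map_snd continuous_map_fst] by (simp add: comp_def)
  have c3: "continuous_map ?P (mtopology_of Z) (\<lambda>w. snd (snd w))"
    using continuous_map_compose[OF continuous_map_snd continuous_map_snd] by (simp add: comp_def)
  define C1 where "C1 = {w \<in> topspace ?P. p (fst w) = p (fst (snd w))}"
  define C2 where "C2 n = {w \<in> topspace ?P. mdist X (int_iter X T n (fst w)) (int_iter X T n (fst (snd w))) \<in> {..\<epsilon>}}" for n
  have "closedin ?P C1"
    unfolding C1_def
    using continuous_map_compose[OF c1 factor_map_continuous[OF p]] continuous_map_compose[OF c2 factor_map_continuous[OF p]]
    by (intro closedin_continuous_maps_eq[OF Hausdorff_space_mtopology_of[of Y]]) (simp_all add: comp_def)
  moreover have "closedin ?P (C2 n)" for n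
  proof -
    have it: "continuous_map (mtopology_of X) (mtopology_of X) (int_iter X T n)"
      by (rule homeomorphic_imp_continuous_map[OF homeomorphic_map_int_iter[OF X]])
    have "continuous_map ?P euclidean (\<lambda>w. mdist X (int_iter X T n (fst w)) (int_iter X T n (fst (snd w))))"
      using continuous_map_compose[OF c1 it] continuous_map_compose[OF c2 it]
      by (intro continuous_map_mdist) (simp_all add: comp_def)
    then show ?thesis unfolding C2_def by (rule closedin_continuous_map_preimage) simp
  qed
  moreover have "closedin ?P (mspace X \<times> J)"
    using J(1) closedin_topspace[of "mtopology_of X"] by (simp add: closedin_prod_Times_iff)
  ultimately have "closedin ?P (mspace X \<times> J \<inter> C1 \<inter> (\<Inter>n. C2 n))"
    by (intro closedin_Int closedin_INT) auto
  moreover have "closed_map ?P (prod_mtopology X Z) (\<lambda>w. (fst w, snd (snd w)))"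
    using X Z by (intro continuous_imp_closed_map continuous_map_pairedI c1 c3 Hausdorff_prod_mtopology)
      (simp add: dyn_system_def compact_space_prod_topology)
  ultimately have "closedin (prod_mtopology X Z) ((\<lambda>w. (fst w, snd (snd w))) ` (mspace X \<times> J \<inter> C1 \<inter> (\<Inter>n. C2 n)))"
    unfolding closed_map_def by blast
  moreover have "(\<lambda>w. (fst w, snd (snd w))) ` (mspace X \<times> J \<inter> C1 \<inter> (\<Inter>n. C2 n)) = N"
  proof
    show "(\<lambda>w. (fst w, snd (snd w))) ` (mspace X \<times> J \<inter> C1 \<inter> (\<Inter>n. C2 n)) \<subseteq> N"
    proof
      fix v assume "v \<in> (\<lambda>w. (fst w, snd (snd w))) ` (mspace X \<times> J \<inter> C1 \<inter> (\<Inter>n. C2 n))"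
      then obtain w where w: "w \<in> mspace X \<times> J" "w \<in> C1" "\<And>n. w \<in> C2 n" "v = (fst w, snd (snd w))" by blast
      obtain x x' z where "w = (x, x', z)" by (metis prod_cases3)
      then show "v \<in> N" using w unfolding N_def C1_def C2_def by auto
    qed
    show "N \<subseteq> (\<lambda>w. (fst w, snd (snd w))) ` (mspace X \<times> J \<inter> C1 \<inter> (\<Inter>n. C2 n))"
    proof
      fix v assume "v \<in> N"
      then obtain x x' z where v: "v = (x, z)" "x \<in> mspace X" "p x' = p x" "(x', z) \<in> J"
        "\<And>n. mdist X (int_iter X T n x) (int_iter X T n x') \<le> \<epsilon>" unfolding N_def by blast
      have "x' \<in> mspace X" "z \<in> mspace Z" using v(4) JXZ by auto
      then have "(x, x', z) \<in> mspace X \<times> J \<inter> C1 \<inter> (\<Inter>n. C2 n)"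
        using v by (simp add: C1_def C2_def)
      then show "v \<in> (\<lambda>w. (fst w, snd (snd w))) ` (mspace X \<times> J \<inter> C1 \<inter> (\<Inter>n. C2 n))"
        using v(1) by (intro image_eqI[of _ _ "(x, x', z)"]) auto
    qed
  qed
  ultimately have "closedin (prod_mtopology X Z) N" by simp
  then show "closedin (prod_mtopology X Z) (fibre_neighbourhood X T p J \<epsilon>)"
    by (simp add: N_def fibre_neighbourhood_def)
  have "map_prod T S ` N = N"
  proof (rule map_prod_image_eqI[OF X Z])
    show "N \<subseteq> mspace X \<times> mspace Z" using JXZ by (auto simp: N_def)
    fix m x z assume "(x, z) \<in> N"
    then obtain x' where x: "x \<in> mspace X" and x': "p x' = p x" "(x', z) \<in> J"
      and d: "\<And>n. mdist X (int_iter X T n x) (int_iter X T n x') \<le> \<epsilon>" by (auto simp: N_def)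
    have x'X: "x' \<in> mspace X" using x'(2) JXZ by auto
    have "p (int_iter X T m x') = p (int_iter X T m x)"
      using factor_map_int_iter[OF p x] factor_map_int_iter[OF p x'X] x'(1) by simp
    moreover have "(int_iter X T m x', int_iter Z S m z) \<in> J"
      by (rule prod_int_iter_invariant[OF X Z JXZ J(2) x'(2)])
    moreover have "mdist X (int_iter X T n (int_iter X T m x)) (int_iter X T n (int_iter X T m x')) \<le> \<epsilon>" for n
      using d[of "n + m"] by (simp add: int_iter_add[OF X x] int_iter_add[OF X x'X])
    ultimately show "(int_iter X T m x, int_iter Z S m z) \<in> N"
      using int_iter_in[OF X x] unfolding N_def by blast
  qed
  then show "map_prod T S ` fibre_neighbourhood X T p J \<epsilon> = fibre_neighbourhood X T p J \<epsilon>"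
    by (simp add: N_def fibre_neighbourhood_def)
qed

subsection \<open>Joinings over open sets of the equicontinuous factors\<close>

text \<open>If the part of \<open>J\<close> over the saturation of \<open>O1 \<times> O2\<close> had an image in \<open>Y \<times> Z\<close> missing part of
  the open set \<open>\<Omega>\<close> below, replacing everything over \<open>\<Omega>\<close> by that image would give a proper joining
  that still maps onto the product of the maximal equicontinuous factors.\<close>

lemma quasi_disjoint_local_image:
  fixes Xeq :: "'e metric" and Y :: "'b metric" and Z :: "'c metric" and Zeq :: "'c metric"
  assumes X: "minimal_system X T" and Z: "minimal_system Z S" and p: "factor_map X T Y T' p"
    and E: "max_equicontinuous_factor X T Xeq U q" and F: "max_equicontinuous_factor Z S Zeq R s"
    and qd: "quasi_disjoint Y T' Z S"
    and J: "closedin (prod_mtopology X Z) J" "map_prod T S ` J = J"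
    and full: "map_prod q s ` J = mspace Xeq \<times> mspace Zeq"
    and O1: "openin (mtopology_of Xeq) O1" "O1 \<noteq> {}" and O2: "openin (mtopology_of Zeq) O2" "O2 \<noteq> {}"
  obtains J' G where "closedin (prod_mtopology X Z) J'" "J' \<subseteq> J"
    "openin (prod_mtopology Y Z) G" "G \<noteq> {}" "G \<subseteq> map_prod p id ` J'"
    "\<And>x z. (x, z) \<in> J' \<Longrightarrow> \<exists>n. q (int_iter X T n x) \<in> O1 \<and> s (int_iter Z S n z) \<in> O2"
proof -
  have sX: "dyn_system X T" and sZ: "dyn_system Z S" using X Z by (auto simp: minimal_system_dyn)
  have sY: "dyn_system Y T'" using factor_map_dyn[OF p] by simp
  have Y: "minimal_system Y T'" by (rule minimal_factor[OF X p])
  have q: "factor_map X T Xeq U q" and eqE: "equicontinuous_system Xeq U"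
    using E by (auto simp: max_equicontinuous_factor_def)
  have s: "factor_map Z S Zeq R s" and eqF: "equicontinuous_system Zeq R"
    using F by (auto simp: max_equicontinuous_factor_def)
  have sE: "dyn_system Xeq U" and sF: "dyn_system Zeq R" using factor_map_dyn[OF q] factor_map_dyn[OF s] by auto
  have JXZ: "J \<subseteq> mspace X \<times> mspace Z" using closedin_subset[OF J(1)] by simp
  \<comment> \<open>This factor has its carrier in the type of \<open>Y\<close>, as the definition
    of quasi-disjointness asks. The factor \<open>Xeq\<close> maps onto it by \<open>h\<close>,
    through the universal property for targets of arbitrary type.\<close>
  obtain Yeq :: "'b metric" and V pY where EY: "max_equicontinuous_factor Y T' Yeq V pY"
    using max_equicontinuous_factor_exists[OF sY] by metis
  have pY: "factor_map Y T' Yeq V pY" and eqY: "equicontinuous_system Yeq V"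
    using EY by (auto simp: max_equicontinuous_factor_def)
  have sYeq: "dyn_system Yeq V" using factor_map_dyn[OF pY] by simp
  obtain h where h: "factor_map Xeq U Yeq V h" and hq: "\<And>x. x \<in> mspace X \<Longrightarrow> pY (p x) = h (q x)"
    using max_equicontinuous_factor_universal[OF E eqY factor_map_compose[OF p pY]] by auto
  obtain a where a: "a \<in> O1" using O1(2) by blast
  obtain b where b: "b \<in> O2" using O2(2) by blast
  have aE: "a \<in> mspace Xeq" using a openin_subset[OF O1(1)] by auto
  have bF: "b \<in> mspace Zeq" using b openin_subset[OF O2(1)] by auto
  obtain r1 where r1: "r1 > 0" "\<forall>y\<in>mspace Xeq. mdist Xeq a y < r1 \<longrightarrow> y \<in> O1"
    using O1(1) a unfolding openin_mtopology_of by meson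
  obtain r2 where r2: "r2 > 0" "\<forall>y\<in>mspace Zeq. mdist Zeq b y < r2 \<longrightarrow> y \<in> O2"
    using O2(1) b unfolding openin_mtopology_of by meson
  \<comment> \<open>The radii are halved because \<open>J'\<close> is a closure: its points need
    only be orbit-close to points that visit these balls.\<close>
  define Ba where "Ba = {y \<in> mspace Xeq. mdist Xeq a y < r1 / 2}"
  define Bb where "Bb = {y \<in> mspace Zeq. mdist Zeq b y < r2 / 2}"
  have Ba: "openin (mtopology_of Xeq) Ba" "a \<in> Ba"
    unfolding Ba_def using openin_mdist_ball[OF aE, of "r1 / 2"] aE r1(1) by (simp_all add: mdist_self)
  have Bb: "openin (mtopology_of Zeq) Bb" "b \<in> Bb"
    unfolding Bb_def using openin_mdist_ball[OF bF, of "r2 / 2"] bF r2(1) by (simp_all add: mdist_self)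
  define A where "A = {x \<in> mspace X. q x \<in> Ba}"
  define B where "B = {z \<in> mspace Z. s z \<in> Bb}"
  have B: "openin (mtopology_of Z) B"
    using openin_continuous_map_preimage[OF factor_map_continuous[OF s] Bb(1)] by (simp add: B_def)
  define L where "L = orbit_saturation X T Z S A B"
  have Lsub: "J \<inter> L \<subseteq> mspace X \<times> mspace Z" using JXZ by auto
  have JL: "map_prod T S ` (J \<inter> L) = J \<inter> L"
  proof (rule map_prod_image_eqI[OF sX sZ Lsub])
    fix n x z assume xz: "(x, z) \<in> J \<inter> L"
    then have "x \<in> mspace X" "z \<in> mspace Z" using JXZ by auto
    then show "(int_iter X T n x, int_iter Z S n z) \<in> J \<inter> L"
      using xz orbit_saturation_int_iter[OF sX sZ, of x z n A B]
        prod_int_iter_invariant[OF sX sZ JXZ J(2), of x z n] by (simp add: L_def)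
  qed
  define J' where "J' = prod_mtopology X Z closure_of (J \<inter> L)"
  have J'cl: "closedin (prod_mtopology X Z) J'" by (simp add: J'_def)
  have J'J: "J' \<subseteq> J" unfolding J'_def using J(1) by (intro closure_of_minimal) auto
  have J'inv: "map_prod T S ` J' = J'"
    unfolding J'_def by (rule closure_of_prod_invariant[OF sX sZ Lsub JL])
  have JLJ': "J \<inter> L \<subseteq> J'"
    unfolding J'_def using Lsub by (intro closure_of_subset) simp
  \<comment> \<open>A point of \<open>J'\<close> is a limit of points of
    \<open>J \<inter> L\<close>. Equicontinuity of both factors keeps the projected orbits of a
    nearby point within half a radius at all times, so the visiting time is shared.\<close>
  have hit: "\<exists>n. q (int_iter X T n x) \<in> O1 \<and> s (int_iter Z S n z) \<in> O2" if xz: "(x, z) \<in> J'" for x z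
  proof -
    have xX: "x \<in> mspace X" and zZ: "z \<in> mspace Z" using xz J'J JXZ by auto
    obtain d1 where d1: "d1 > 0" "\<forall>c\<in>mspace Xeq. \<forall>c'\<in>mspace Xeq. mdist Xeq c c' < d1 \<longrightarrow>
        (\<forall>n. mdist Xeq (int_iter Xeq U n c) (int_iter Xeq U n c') < r1 / 2)"
      using eqE r1(1) unfolding equicontinuous_system_def by (meson half_gt_zero)
    obtain d2 where d2: "d2 > 0" "\<forall>c\<in>mspace Zeq. \<forall>c'\<in>mspace Zeq. mdist Zeq c c' < d2 \<longrightarrow>
        (\<forall>n. mdist Zeq (int_iter Zeq R n c) (int_iter Zeq R n c') < r2 / 2)"
      using eqF r2(1) unfolding equicontinuous_system_def by (meson half_gt_zero)
    define Q1 where "Q1 = {x' \<in> mspace X. q x' \<in> {c \<in> mspace Xeq. mdist Xeq (q x) c < d1}}"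
    define Q2 where "Q2 = {z' \<in> mspace Z. s z' \<in> {c \<in> mspace Zeq. mdist Zeq (s z) c < d2}}"
    have "openin (mtopology_of X) Q1"
      using openin_continuous_map_preimage[OF factor_map_continuous[OF q] openin_mdist_ball[OF factor_map_in[OF q xX], of d1]]
      by (simp add: Q1_def)
    moreover have "openin (mtopology_of Z) Q2"
      using openin_continuous_map_preimage[OF factor_map_continuous[OF s] openin_mdist_ball[OF factor_map_in[OF s zZ], of d2]]
      by (simp add: Q2_def)
    ultimately have "openin (prod_mtopology X Z) (Q1 \<times> Q2)" by (simp add: openin_prod_Times_iff)
    moreover have "(x, z) \<in> Q1 \<times> Q2"
      using xX zZ d1(1) d2(1) factor_map_in[OF q xX] factor_map_in[OF s zZ]
      by (simp add: Q1_def Q2_def mdist_self)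
    ultimately obtain w where w: "w \<in> J \<inter> L" "w \<in> Q1 \<times> Q2"
      using xz unfolding J'_def in_closure_of by meson
    obtain x' z' where w': "w = (x', z')" by (cases w)
    have x': "x' \<in> mspace X" "q x' \<in> mspace Xeq" "mdist Xeq (q x) (q x') < d1"
      and z': "z' \<in> mspace Z" "s z' \<in> mspace Zeq" "mdist Zeq (s z) (s z') < d2"
      using w(2) by (auto simp: w' Q1_def Q2_def)
    obtain n where n: "int_iter X T n x' \<in> A" "int_iter Z S n z' \<in> B"
      using w(1) by (auto simp: w' L_def orbit_saturation_def)
    have "mdist Xeq a (q (int_iter X T n x)) < r1"
    proof -
      have "mdist Xeq (q (int_iter X T n x)) (q (int_iter X T n x')) < r1 / 2"
        using d1(2) factor_map_in[OF q xX] x' factor_map_int_iter[OF q xX] factor_map_int_iter[OF q x'(1)] by simp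
      moreover have "mdist Xeq a (q (int_iter X T n x')) < r1 / 2" using n(1) by (simp add: A_def Ba_def)
      moreover have "mdist Xeq a (q (int_iter X T n x))
          \<le> mdist Xeq a (q (int_iter X T n x')) + mdist Xeq (q (int_iter X T n x')) (q (int_iter X T n x))"
        by (intro mdist_triangle aE factor_map_in[OF q] int_iter_in[OF sX] xX x'(1))
      ultimately show ?thesis by (simp add: mdist_commute)
    qed
    moreover have "mdist Zeq b (s (int_iter Z S n z)) < r2"
    proof -
      have "mdist Zeq (s (int_iter Z S n z)) (s (int_iter Z S n z')) < r2 / 2"
        using d2(2) factor_map_in[OF s zZ] z' factor_map_int_iter[OF s zZ] factor_map_int_iter[OF s z'(1)] by simp
      moreover have "mdist Zeq b (s (int_iter Z S n z')) < r2 / 2" using n(2) by (simp add: B_def Bb_def)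
      moreover have "mdist Zeq b (s (int_iter Z S n z))
          \<le> mdist Zeq b (s (int_iter Z S n z')) + mdist Zeq (s (int_iter Z S n z')) (s (int_iter Z S n z))"
        by (intro mdist_triangle bF factor_map_in[OF s] int_iter_in[OF sZ] zZ z'(1))
      ultimately show ?thesis by (simp add: mdist_commute)
    qed
    ultimately show ?thesis
      using r1(2) r2(2) factor_map_in[OF q int_iter_in[OF sX xX, of n]]
        factor_map_in[OF s int_iter_in[OF sZ zZ, of n]] by blast
  qed
  have Ba': "Ba \<noteq> {}" using Ba(2) by blast
  \<comment> \<open>Every point of \<open>OY\<close> lifts through \<open>h\<close> to
    \<open>Ba\<close>, which is what allows points over \<open>C\<close> to be matched by points of
    \<open>J\<close> over \<open>Ba\<close>.\<close>
  obtain OY where OY: "openin (mtopology_of Yeq) OY" "OY \<noteq> {}" "OY \<subseteq> h ` Ba"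
    using minimal_factor_semiopen[OF minimal_factor[OF X q] h Ba(1) Ba'] by metis
  define C where "C = {y \<in> mspace Y. pY y \<in> OY}"
  have C: "openin (mtopology_of Y) C"
    using openin_continuous_map_preimage[OF factor_map_continuous[OF pY] OY(1)] by (simp add: C_def)
  define \<Omega> where "\<Omega> = orbit_saturation Y T' Z S C B"
  have \<Omega>op: "openin (prod_mtopology Y Z) \<Omega>"
    unfolding \<Omega>_def by (rule openin_orbit_saturation[OF sY sZ C B])
  define I where "I = map_prod p id ` J'"
  have Icl: "closedin (prod_mtopology Y Z) I"
    unfolding I_def by (rule closedin_map_prod_factor[OF p factor_map_id[OF sZ] J'cl])
  have IYZ: "I \<subseteq> mspace Y \<times> mspace Z" using closedin_subset[OF Icl] by simp
  have Iinv: "map_prod T' S ` I = I"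
    unfolding I_def
    by (rule map_prod_factor_invariant[OF p factor_map_id[OF sZ] subset_trans[OF J'J JXZ] J'inv])
  define K where "K = I \<union> (mspace Y \<times> mspace Z - \<Omega>)"
  have KYZ: "K \<subseteq> mspace Y \<times> mspace Z" using IYZ by (auto simp: K_def)
  have Kcl: "closedin (prod_mtopology Y Z) K"
    unfolding K_def
    using closedin_Un[OF Icl closedin_diff[OF closedin_topspace \<Omega>op]] by simp
  have Kinv: "map_prod T' S ` K = K"
  proof (rule map_prod_image_eqI[OF sY sZ KYZ])
    fix n y z assume yz: "(y, z) \<in> K"
    then have y: "y \<in> mspace Y" and z: "z \<in> mspace Z" using KYZ by auto
    show "(int_iter Y T' n y, int_iter Z S n z) \<in> K"
    proof (cases "(y, z) \<in> I")
      case True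
      then show ?thesis using prod_int_iter_invariant[OF sY sZ IYZ Iinv] by (simp add: K_def)
    next
      case False
      then have "(y, z) \<notin> \<Omega>" using yz by (simp add: K_def)
      then show ?thesis
        using orbit_saturation_int_iter[OF sY sZ y z, of n C B] int_iter_in[OF sY y] int_iter_in[OF sZ z]
        by (simp add: K_def \<Omega>_def)
    qed
  qed
  have Kfull: "map_prod pY s ` K = mspace Yeq \<times> mspace Zeq"
  proof
    show "map_prod pY s ` K \<subseteq> mspace Yeq \<times> mspace Zeq"
      using KYZ factor_map_in[OF pY] factor_map_in[OF s] by auto
    show "mspace Yeq \<times> mspace Zeq \<subseteq> map_prod pY s ` K"
    proof
      fix w assume "w \<in> mspace Yeq \<times> mspace Zeq"
      then obtain c e where w: "w = (c, e)" "c \<in> mspace Yeq" "e \<in> mspace Zeq" by blast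
      obtain y where y: "y \<in> mspace Y" "pY y = c" by (rule factor_map_surj[OF pY w(2)])
      obtain z where z: "z \<in> mspace Z" "s z = e" by (rule factor_map_surj[OF s w(3)])
      show "w \<in> map_prod pY s ` K"
      proof (cases "(y, z) \<in> \<Omega>")
        case False
        then have "(y, z) \<in> K" using y z by (simp add: K_def)
        moreover have "w = map_prod pY s (y, z)" using w y z by simp
        ultimately show ?thesis by (rule rev_image_eqI)
      next
        \<comment> \<open>The orbit of the pair is followed to a time \<open>n\<close> at which it
          lies over \<open>OY\<close> and \<open>Bb\<close>. Fullness of \<open>J\<close> gives a
          pair in \<open>J \<inter> L\<close> with the same projections, and moving it back by
          \<open>n\<close> steps gives a point of \<open>K\<close> over \<open>w\<close>.\<close>
        case True
        then obtain n where n: "int_iter Y T' n y \<in> C" "int_iter Z S n z \<in> B"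
          by (auto simp: \<Omega>_def orbit_saturation_def)
        have "pY (int_iter Y T' n y) \<in> h ` Ba" using n(1) OY(3) by (auto simp: C_def)
        then obtain a' where a': "a' \<in> Ba" "pY (int_iter Y T' n y) = h a'" by blast
        have a'E: "a' \<in> mspace Xeq" using a'(1) by (simp add: Ba_def)
        have "(a', s (int_iter Z S n z)) \<in> map_prod q s ` J"
          using full a'E factor_map_in[OF s int_iter_in[OF sZ z(1)]] by simp
        then obtain x1 z1 where xz: "(x1, z1) \<in> J" "q x1 = a'" "s z1 = s (int_iter Z S n z)" by auto
        have x1: "x1 \<in> mspace X" and z1: "z1 \<in> mspace Z" using xz(1) JXZ by auto
        have "x1 \<in> A" using x1 xz(2) a'(1) by (simp add: A_def)
        moreover have "z1 \<in> B" using z1 xz(3) n(2) by (simp add: B_def)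
        ultimately have "\<exists>m. int_iter X T m x1 \<in> A \<and> int_iter Z S m z1 \<in> B"
          by (intro exI[of _ 0]) simp
        then have "(x1, z1) \<in> J \<inter> L"
          using x1 z1 xz(1) by (simp add: L_def orbit_saturation_def)
        then have "(int_iter X T (- n) x1, int_iter Z S (- n) z1) \<in> J'"
          using prod_int_iter_invariant[OF sX sZ Lsub JL] JLJ' by blast
        then have "map_prod p id (int_iter X T (- n) x1, int_iter Z S (- n) z1) \<in> K"
          unfolding K_def I_def by blast
        then have inK: "(p (int_iter X T (- n) x1), int_iter Z S (- n) z1) \<in> K" by simp
        have "pY (p (int_iter X T (- n) x1)) = h (int_iter Xeq U (- n) a')"
          using hq[OF int_iter_in[OF sX x1]] factor_map_int_iter[OF q x1] xz(2) by simp
        also have "\<dots> = int_iter Yeq V (- n) (h a')" by (rule factor_map_int_iter[OF h a'E])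
        also have "\<dots> = int_iter Yeq V (- n) (int_iter Yeq V n c)"
          using a'(2) factor_map_int_iter[OF pY y(1)] y(2) by simp
        also have "\<dots> = c" by (rule int_iter_inverse(2)[OF sYeq w(2)])
        finally have 1: "pY (p (int_iter X T (- n) x1)) = c" .
        have "s (int_iter Z S (- n) z1) = int_iter Zeq R (- n) (int_iter Zeq R n e)"
          using factor_map_int_iter[OF s z1] xz(3) factor_map_int_iter[OF s z(1)] z(2) by simp
        also have "\<dots> = e" by (rule int_iter_inverse(2)[OF sF w(3)])
        finally have 2: "s (int_iter Z S (- n) z1) = e" .
        have "w = map_prod pY s (p (int_iter X T (- n) x1), int_iter Z S (- n) z1)"
          using w(1) 1 2 by simp
        with inK show ?thesis by (rule rev_image_eqI)
      qed
    qed
  qed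
  obtain c where c: "c \<in> OY" using OY(2) by blast
  obtain y0 where y0: "y0 \<in> mspace Y" "pY y0 = c"
    using factor_map_surj[OF pY, of c] c openin_subset[OF OY(1)] by auto
  obtain z0 where z0: "z0 \<in> mspace Z" "s z0 = b" by (rule factor_map_surj[OF s bF])
  have "y0 \<in> C" "z0 \<in> B" using y0 c z0 Bb(2) by (simp_all add: C_def B_def)
  then have "\<exists>n. int_iter Y T' n y0 \<in> C \<and> int_iter Z S n z0 \<in> B" by (intro exI[of _ 0]) simp
  then have \<Omega>ne: "(y0, z0) \<in> \<Omega>" using y0 z0 by (simp add: \<Omega>_def orbit_saturation_def)
  \<comment> \<open>The projections of \<open>K\<close> are closed and invariant, so nonemptiness
    and minimality make them full.\<close>
  have Kne: "K \<noteq> {}"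
  proof
    assume "K = {}"
    then have "mspace Yeq \<times> mspace Zeq = {}" using Kfull by simp
    then show False using factor_map_in[OF pY y0(1)] bF by blast
  qed
  have "fst ` K = mspace Y"
  proof (rule minimal_closed_invariant[OF Y])
    show "closedin (mtopology_of Y) (fst ` K)"
      using closed_map_fst[of "mtopology_of Z" "mtopology_of Y"] sZ Kcl
      by (simp add: closed_map_def dyn_system_def)
    show "T' ` fst ` K \<subseteq> fst ` K"
    proof -
      have "T' ` fst ` K = fst ` map_prod T' S ` K" by (simp add: image_image)
      then show ?thesis using Kinv by simp
    qed
  qed (use Kne in simp)
  moreover have "snd ` K = mspace Z"
  proof (rule minimal_closed_invariant[OF Z])
    show "closedin (mtopology_of Z) (snd ` K)"
      using closed_map_snd[of "mtopology_of Y" "mtopology_of Z"] sY Kcl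
      by (simp add: closed_map_def dyn_system_def)
    show "S ` snd ` K \<subseteq> snd ` K"
    proof -
      have "S ` snd ` K = snd ` map_prod T' S ` K" by (simp add: image_image)
      then show ?thesis using Kinv by simp
    qed
  qed (use Kne in simp)
  ultimately have "joining Y T' Z S K" using Kcl Kinv by (simp add: joining_def)
  then have "K \<in> {J. joining Y T' Z S J \<and> map_prod pY s ` J = mspace Yeq \<times> mspace Zeq}"
    using Kfull by simp
  also have "\<dots> = {mspace Y \<times> mspace Z}"
    by (rule qd[unfolded quasi_disjoint_def, rule_format, OF conjI[OF EY F]])
  finally have "K = mspace Y \<times> mspace Z" by simp
  then have "mspace Y \<times> mspace Z - \<Omega> \<union> I = mspace Y \<times> mspace Z" by (simp add: K_def Un_commute)
  moreover have "\<Omega> \<subseteq> mspace Y \<times> mspace Z" unfolding \<Omega>_def by (rule orbit_saturation_subset)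
  ultimately have \<Omega>I: "\<Omega> \<subseteq> map_prod p id ` J'" unfolding I_def by blast
  have "\<Omega> \<noteq> {}" using \<Omega>ne by (metis empty_iff)
  from that[OF J'cl J'J \<Omega>op this \<Omega>I hit] show ?thesis .
qed

section \<open>Interior points and fullness of fibre neighbourhoods\<close>

text \<open>\<open>J'\<close> is cut into finitely many closed pieces with small first coordinate,
  and the image of one piece has interior. A pair over this interior whose first coordinate is near
  the piece has a partner in the same fibre at distance below \<open>\<delta>\<close>, and
  equicontinuity keeps the two orbits \<open>\<epsilon>\<close>-close.\<close>

lemma fibre_neighbourhood_interior:
  assumes p: "equicontinuous_extension X T Y T' p" and sZ: "dyn_system Z S" and \<epsilon>: "\<epsilon> > 0"
    and J: "closedin (prod_mtopology X Z) J" "map_prod T S ` J = J"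
    and J': "closedin (prod_mtopology X Z) J'" "J' \<subseteq> J"
    and G: "openin (prod_mtopology Y Z) G" "G \<noteq> {}" "G \<subseteq> map_prod p id ` J'"
    and hit: "\<And>x z. (x, z) \<in> J' \<Longrightarrow> \<exists>n. int_iter X T n x \<in> A \<and> int_iter Z S n z \<in> B"
  obtains U V x z where "openin (mtopology_of X) U" "openin (mtopology_of Z) V"
    "x \<in> U" "z \<in> V" "x \<in> A" "z \<in> B" "U \<times> V \<subseteq> fibre_neighbourhood X T p J \<epsilon>"
proof -
  have f: "factor_map X T Y T' p" using p by (simp add: equicontinuous_extension_def)
  have sX: "dyn_system X T" and sY: "dyn_system Y T'" using factor_map_dyn[OF f] by auto
  have JXZ: "J \<subseteq> mspace X \<times> mspace Z" using closedin_subset[OF J(1)] by simp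
  obtain \<delta> where \<delta>: "\<delta> > 0" "\<forall>x1\<in>mspace X. \<forall>x2\<in>mspace X. p x1 = p x2 \<and> mdist X x1 x2 < \<delta> \<longrightarrow>
      (\<forall>n. mdist X (int_iter X T n x1) (int_iter X T n x2) < \<epsilon>)"
    using p \<epsilon> unfolding equicontinuous_extension_def by meson
  define N where "N = fibre_neighbourhood X T p J \<epsilon>"
  have Ninv: "map_prod T S ` N = N" and Ncl: "closedin (prod_mtopology X Z) N"
    unfolding N_def by (rule fibre_neighbourhood_closed_invariant[OF f sZ J])+
  have NXZ: "N \<subseteq> mspace X \<times> mspace Z" using closedin_subset[OF Ncl] by simp
  obtain K where K: "finite K" "K \<subseteq> mspace X" "\<And>x. x \<in> mspace X \<Longrightarrow> \<exists>a\<in>K. mdist X a x < \<delta> / 3"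
    using compact_metric_finite_net[of X "\<delta> / 3"] sX \<delta>(1) unfolding dyn_system_def by (metis divide_pos_pos zero_less_numeral)
  define C where "C a = map_prod p id ` (J' \<inter> {x \<in> mspace X. mdist X a x \<le> \<delta> / 3} \<times> mspace Z)" for a
  have Ccl: "closedin (prod_mtopology Y Z) (C a)" if a: "a \<in> K" for a
    unfolding C_def
  proof (intro closedin_map_prod_factor[OF f factor_map_id[OF sZ]] closedin_Int J'(1))
    have "a \<in> mspace X" using K(2) a by blast
    then show "closedin (prod_mtopology X Z) ({x \<in> mspace X. mdist X a x \<le> \<delta> / 3} \<times> mspace Z)"
      using closedin_mdist_cball[of a X "\<delta> / 3"] closedin_topspace[of "mtopology_of Z"]
      by (simp add: closedin_prod_Times_iff)
  qed
  have cov: "G \<subseteq> (\<Union>a\<in>K. C a)"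
  proof
    fix w assume "w \<in> G"
    then have "w \<in> map_prod p id ` J'" using G(3) by blast
    then obtain x z where xz: "(x, z) \<in> J'" "w = map_prod p id (x, z)" by (metis imageE surj_pair)
    have "x \<in> mspace X" "z \<in> mspace Z" using xz(1) J'(2) JXZ by auto
    moreover obtain a where "a \<in> K" "mdist X a x < \<delta> / 3" using K(3)[OF \<open>x \<in> mspace X\<close>] by blast
    ultimately have "(x, z) \<in> J' \<inter> {x \<in> mspace X. mdist X a x \<le> \<delta> / 3} \<times> mspace Z"
      using xz(1) by simp
    then have "w \<in> C a" unfolding C_def xz(2) by (rule imageI)
    then show "w \<in> (\<Union>a\<in>K. C a)" using \<open>a \<in> K\<close> by blast
  qed
  obtain a G' where a: "a \<in> K" and G': "openin (prod_mtopology Y Z) G'" "G' \<noteq> {}" "G' \<subseteq> C a"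
    using finite_closed_Union_interior[OF K(1) Ccl G(1,2) cov] by metis
  have aX: "a \<in> mspace X" using a K(2) by blast
  \<comment> \<open>The radius \<open>\<delta> / 2\<close> exceeds the radius
    \<open>\<delta> / 3\<close> of the pieces, so \<open>H\<close> contains points of
    \<open>J'\<close>, while the sum of the two radii is still below
    \<open>\<delta>\<close>.\<close>
  define H where "H = {w \<in> mspace X \<times> mspace Z. fst w \<in> {x \<in> mspace X. mdist X a x < \<delta> / 2} \<and> map_prod p id w \<in> G'}"
  have Hop: "openin (prod_mtopology X Z) H"
  proof -
    have "continuous_map (prod_mtopology X Z) (prod_mtopology Y Z) (map_prod p id)"
      by (rule continuous_map_map_prod[OF factor_map_continuous[OF f] continuous_map_id])
    from openin_continuous_map_preimage[OF this G'(1)]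
    have "openin (prod_mtopology X Z) {w \<in> mspace X \<times> mspace Z. map_prod p id w \<in> G'}" by simp
    moreover have "openin (prod_mtopology X Z) {w \<in> mspace X \<times> mspace Z. fst w \<in> {x \<in> mspace X. mdist X a x < \<delta> / 2}}"
      using openin_continuous_map_preimage[OF continuous_map_fst openin_mdist_ball[OF aX, of "\<delta> / 2"], of "mtopology_of Z"]
      by simp
    ultimately have "openin (prod_mtopology X Z) ({w \<in> mspace X \<times> mspace Z. fst w \<in> {x \<in> mspace X. mdist X a x < \<delta> / 2}}
        \<inter> {w \<in> mspace X \<times> mspace Z. map_prod p id w \<in> G'})" by (intro openin_Int)
    moreover have "{w \<in> mspace X \<times> mspace Z. fst w \<in> {x \<in> mspace X. mdist X a x < \<delta> / 2}}
        \<inter> {w \<in> mspace X \<times> mspace Z. map_prod p id w \<in> G'} = H" by (auto simp: H_def)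
    ultimately show ?thesis by simp
  qed
  have HN: "H \<subseteq> N"
  proof
    fix w assume w: "w \<in> H"
    obtain x z where xz: "w = (x, z)" by (cases w)
    have x: "x \<in> mspace X" "mdist X a x < \<delta> / 2" and "(p x, z) \<in> C a"
      using w G'(3) by (auto simp: H_def xz)
    then obtain x' where x': "(x', z) \<in> J'" "x' \<in> mspace X" "mdist X a x' \<le> \<delta> / 3" "p x' = p x"
      by (auto simp: C_def)
    have "mdist X x x' \<le> mdist X x a + mdist X a x'" by (rule mdist_triangle[OF x(1) aX x'(2)])
    then have "mdist X x x' < \<delta>" using x(2) x'(3) \<delta>(1) by (simp add: mdist_commute)
    then have "mdist X (int_iter X T n x) (int_iter X T n x') \<le> \<epsilon>" for n
      using \<delta>(2) x(1) x'(2,4) by (simp add: less_imp_le)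
    moreover have "(x', z) \<in> J" using x'(1) J'(2) by blast
    ultimately show "w \<in> N" using x(1) x'(4) unfolding N_def fibre_neighbourhood_def xz by blast
  qed
  obtain w where w: "w \<in> G'" using G'(2) by blast
  then have "w \<in> C a" using G'(3) by blast
  then obtain x z where xz: "(x, z) \<in> J'" "x \<in> mspace X" "z \<in> mspace Z" "mdist X a x \<le> \<delta> / 3" "w = (p x, z)"
    by (auto simp: C_def)
  have H: "(x, z) \<in> H" using xz w \<delta>(1) by (simp add: H_def)
  obtain n where n: "int_iter X T n x \<in> A" "int_iter Z S n z \<in> B" using hit[OF xz(1)] by blast
  let ?g = "map_prod (int_iter X T (- n)) (int_iter Z S (- n))"
  \<comment> \<open>\<open>H\<close> is translated by the time at which a point of \<open>J'\<close>
    in it visits \<open>A\<close> and \<open>B\<close>; the translate stays in \<open>N\<close> by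
    invariance.\<close>
  define H' where "H' = {w \<in> mspace X \<times> mspace Z. ?g w \<in> H}"
  have "continuous_map (prod_mtopology X Z) (prod_mtopology X Z) ?g"
    by (intro continuous_map_map_prod homeomorphic_imp_continuous_map homeomorphic_map_int_iter sX sZ)
  from openin_continuous_map_preimage[OF this Hop]
  have H'op: "openin (prod_mtopology X Z) H'" by (simp add: H'_def)
  have H'N: "H' \<subseteq> N"
  proof
    fix v assume v: "v \<in> H'"
    obtain x' z' where v': "v = (x', z')" by (cases v)
    have "x' \<in> mspace X" "z' \<in> mspace Z" "(int_iter X T (- n) x', int_iter Z S (- n) z') \<in> N"
      using v HN by (auto simp: v' H'_def)
    then show "v \<in> N"
      using prod_int_iter_invariant[OF sX sZ NXZ Ninv, of "int_iter X T (- n) x'" "int_iter Z S (- n) z'" n]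
        int_iter_inverse(1)[OF sX, of x' n] int_iter_inverse(1)[OF sZ, of z' n] by (simp add: v')
  qed
  have "(int_iter X T n x, int_iter Z S n z) \<in> H'"
    using H int_iter_in[OF sX xz(2)] int_iter_in[OF sZ xz(3)]
      int_iter_inverse(2)[OF sX xz(2), of n] int_iter_inverse(2)[OF sZ xz(3), of n] by (simp add: H'_def)
  then obtain U V where UV: "openin (mtopology_of X) U" "openin (mtopology_of Z) V"
    "int_iter X T n x \<in> U" "int_iter Z S n z \<in> V" "U \<times> V \<subseteq> H'"
    using H'op[unfolded openin_prod_topology_alt] by meson
  have "U \<times> V \<subseteq> fibre_neighbourhood X T p J \<epsilon>"
    using UV(5) H'N unfolding N_def by (rule subset_trans)
  from that[OF UV(1-4) n this] show ?thesis .
qed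

text \<open>A box \<open>P \<times> Q\<close> outside \<open>N\<close> is confronted with a box
  inside \<open>N\<close> over the same open sets of the equicontinuous factors. The inner box is
  moved into the outer one, first in the second coordinate and then in the first, along fibres of
  the equicontinuous factor maps.\<close>

lemma fibre_neighbourhood_full:
  fixes Xeq :: "'e metric" and Y :: "'b metric" and Z :: "'c metric" and Zeq :: "'c metric"
  assumes X: "minimal_system X T" and Z: "minimal_system Z S"
    and p: "equicontinuous_extension X T Y T' p"
    and E: "max_equicontinuous_factor X T Xeq U q" and F: "max_equicontinuous_factor Z S Zeq R s"
    and qd: "quasi_disjoint Y T' Z S"
    and J: "closedin (prod_mtopology X Z) J" "map_prod T S ` J = J"
    and full: "map_prod q s ` J = mspace Xeq \<times> mspace Zeq" and \<epsilon>: "\<epsilon> > 0"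
  shows "mspace X \<times> mspace Z \<subseteq> fibre_neighbourhood X T p J \<epsilon>"
proof (rule ccontr)
  define N where "N = fibre_neighbourhood X T p J \<epsilon>"
  assume "\<not> mspace X \<times> mspace Z \<subseteq> fibre_neighbourhood X T p J \<epsilon>"
  then obtain w where w: "w \<in> mspace X \<times> mspace Z - N" unfolding N_def by blast
  have f: "factor_map X T Y T' p" using p by (simp add: equicontinuous_extension_def)
  have sX: "dyn_system X T" and sZ: "dyn_system Z S" using X Z by (auto simp: minimal_system_dyn)
  have Ncl: "closedin (prod_mtopology X Z) N" and Ninv: "map_prod T S ` N = N"
    unfolding N_def by (rule fibre_neighbourhood_closed_invariant[OF f sZ J])+
  have q: "factor_map X T Xeq U q" and s: "factor_map Z S Zeq R s"
    using E F by (auto simp: max_equicontinuous_factor_def)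
  have "openin (prod_mtopology X Z) (mspace X \<times> mspace Z - N)"
    using openin_diff[OF openin_topspace Ncl] by simp
  moreover obtain x0 z0 where "w = (x0, z0)" by (cases w)
  ultimately obtain P Q where P: "openin (mtopology_of X) P" "x0 \<in> P" and Q: "openin (mtopology_of Z) Q" "z0 \<in> Q"
    and PQ: "P \<times> Q \<subseteq> mspace X \<times> mspace Z - N"
    using w unfolding openin_prod_topology_alt by blast
  have "P \<noteq> {}" "Q \<noteq> {}" using P(2) Q(2) by auto
  obtain O1 where O1: "openin (mtopology_of Xeq) O1" "O1 \<noteq> {}" "O1 \<subseteq> q ` P"
    using minimal_factor_semiopen[OF X q P(1) \<open>P \<noteq> {}\<close>] by metis
  obtain O2 where O2: "openin (mtopology_of Zeq) O2" "O2 \<noteq> {}" "O2 \<subseteq> s ` Q"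
    using minimal_factor_semiopen[OF Z s Q(1) \<open>Q \<noteq> {}\<close>] by metis
  obtain J' G where J': "closedin (prod_mtopology X Z) J'" "J' \<subseteq> J"
    and G: "openin (prod_mtopology Y Z) G" "G \<noteq> {}" "G \<subseteq> map_prod p id ` J'"
    and hit: "\<And>x z. (x, z) \<in> J' \<Longrightarrow> \<exists>n. q (int_iter X T n x) \<in> O1 \<and> s (int_iter Z S n z) \<in> O2"
    using quasi_disjoint_local_image[OF X Z f E F qd J full O1(1,2) O2(1,2)] by metis
  have "\<exists>n. int_iter X T n x \<in> q -` O1 \<and> int_iter Z S n z \<in> s -` O2" if "(x, z) \<in> J'" for x z
    using hit[OF that] by simp
  from fibre_neighbourhood_interior[OF p sZ \<epsilon> J J' G this]
  obtain M V x z where M: "openin (mtopology_of X) M" and V: "openin (mtopology_of Z) V"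
    and x: "x \<in> M" "q x \<in> O1" and z: "z \<in> V" "s z \<in> O2" and MV: "M \<times> V \<subseteq> N"
    unfolding N_def by (metis vimageD)
  obtain x1 where x1: "x1 \<in> P" "q x1 = q x" using x(2) O1(3) by fastforce
  define V' where "V' = V \<inter> {z \<in> mspace Z. s z \<in> O2}"
  have V'op: "openin (mtopology_of Z) V'"
    unfolding V'_def using openin_continuous_map_preimage[OF factor_map_continuous[OF s] O2(1)] V
    by (intro openin_Int) simp_all
  have "V' \<noteq> {}" using z openin_subset[OF V] by (auto simp: V'_def)
  obtain O3 where O3: "openin (mtopology_of Zeq) O3" "O3 \<noteq> {}" "O3 \<subseteq> s ` V'"
    using minimal_factor_semiopen[OF Z s V'op \<open>V' \<noteq> {}\<close>] by metis
  \<comment> \<open>Every point of \<open>W\<close> shares its image under \<open>s\<close> with a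
    point of \<open>V'\<close>. It is nonempty because \<open>O3\<close> lies in the image of
    \<open>V'\<close>, hence in \<open>O2\<close> and in the image of \<open>Q\<close>.\<close>
  define W where "W = Q \<inter> {z \<in> mspace Z. s z \<in> O3}"
  have Wop: "openin (mtopology_of Z) W"
    unfolding W_def using openin_continuous_map_preimage[OF factor_map_continuous[OF s] O3(1)] Q(1)
    by (intro openin_Int) simp_all
  have "W \<noteq> {}"
  proof -
    obtain e where e: "e \<in> O3" using O3(2) by blast
    then obtain v where "v \<in> V'" "s v = e" using O3(3) by blast
    then have "e \<in> s ` Q" using O2(3) by (auto simp: V'_def)
    then obtain z1 where "z1 \<in> Q" "s z1 = e" by blast
    then have "z1 \<in> W" using e openin_subset[OF Q(1)] by (auto simp: W_def)
    then show ?thesis by blast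
  qed
  have xX: "x \<in> mspace X" and x1X: "x1 \<in> mspace X" using x(1) openin_subset[OF M] x1(1) openin_subset[OF P(1)] by auto
  have "{x} \<times> W \<subseteq> N"
  proof
    fix u assume "u \<in> {x} \<times> W"
    then obtain z1 where z1: "u = (x, z1)" "z1 \<in> mspace Z" "s z1 \<in> O3" by (auto simp: W_def)
    then obtain z2 where z2: "z2 \<in> V'" "s z2 = s z1" using O3(3) by fastforce
    have z2V: "z2 \<in> V" "z2 \<in> mspace Z" using z2(1) by (auto simp: V'_def)
    \<comment> \<open>The transfer in the second coordinate is made one point at a time and yields
      an open \<open>W\<close> over \<open>x\<close>, as the transfer in the first coordinate
      requires.\<close>
    have "M \<times> {z2} \<subseteq> N" using MV z2V(1) by blast
    then have "M \<times> {z1} \<subseteq> N"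
      by (rule section_depends_on_equicontinuous_factor'[OF X Z Ncl Ninv F z2V(2) z1(2) z2(2) M])
    then show "u \<in> N" using x(1) z1(1) by blast
  qed
  then have "{x1} \<times> W \<subseteq> N"
    by (rule section_depends_on_equicontinuous_factor[OF X Z Ncl Ninv E xX x1X x1(2)[symmetric] Wop])
  moreover have "{x1} \<times> W \<subseteq> P \<times> Q" using x1(1) by (auto simp: W_def)
  ultimately show False using PQ \<open>W \<noteq> {}\<close> by blast
qed

theorem theorem5p6:
  fixes X :: "'a metric" and T :: "'a \<Rightarrow> 'a"
    and Y :: "'b metric" and T' :: "'b \<Rightarrow> 'b"
    and Z :: "'c metric" and S :: "'c \<Rightarrow> 'c"
    and \<pi> :: "'a \<Rightarrow> 'b"
  assumes "minimal_system X T"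
    and "minimal_system Z S"
    and "equicontinuous_extension X T Y T' \<pi>"
    and "quasi_disjoint Y T' Z S"
  shows "quasi_disjoint X T Z S"
  unfolding quasi_disjoint_def
proof (intro allI impI, elim conjE)
  fix Xeq :: "'a metric" and U q and Zeq :: "'c metric" and R s
  assume E: "max_equicontinuous_factor X T Xeq U q" and F: "max_equicontinuous_factor Z S Zeq R s"
  have f: "factor_map X T Y T' \<pi>" using assms(3) by (simp add: equicontinuous_extension_def)
  have sX: "dyn_system X T" and sY: "dyn_system Y T'" and sZ: "dyn_system Z S"
    using factor_map_dyn[OF f] assms(2) by (auto simp: minimal_system_dyn)
  have q: "factor_map X T Xeq U q" and s: "factor_map Z S Zeq R s"
    using E F by (auto simp: max_equicontinuous_factor_def)
  obtain Yeq :: "'b metric" and V pY where EY: "max_equicontinuous_factor Y T' Yeq V pY"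
    using max_equicontinuous_factor_exists[OF sY] by metis
  \<comment> \<open>Quasi-disjointness says in particular that the full product is a joining, so
    \<open>Y\<close> and \<open>Z\<close> are both empty or both nonempty. This is what makes the
    projections of the product of \<open>X\<close> and \<open>Z\<close> full.\<close>
  have "mspace Y \<times> mspace Z \<in> {J. joining Y T' Z S J \<and> map_prod pY s ` J = mspace Yeq \<times> mspace Zeq}"
    unfolding assms(4)[unfolded quasi_disjoint_def, rule_format, OF conjI[OF EY F]] by simp
  then have "fst ` (mspace Y \<times> mspace Z) = mspace Y" "snd ` (mspace Y \<times> mspace Z) = mspace Z"
    by (simp_all add: joining_def)
  then have empty: "mspace X = {} \<longleftrightarrow> mspace Z = {}"
    using factor_map_image[OF f] by auto
  show "{J. joining X T Z S J \<and> map_prod q s ` J = mspace Xeq \<times> mspace Zeq} = {mspace X \<times> mspace Z}"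
  proof (intro equalityI subsetI)
    fix J assume "J \<in> {J. joining X T Z S J \<and> map_prod q s ` J = mspace Xeq \<times> mspace Zeq}"
    then have J: "closedin (prod_mtopology X Z) J" "map_prod T S ` J = J"
      and full: "map_prod q s ` J = mspace Xeq \<times> mspace Zeq"
      by (auto simp: joining_def)
    have JXZ: "J \<subseteq> mspace X \<times> mspace Z" using closedin_subset[OF J(1)] by simp
    have "(x, z) \<in> J" if x: "x \<in> mspace X" and z: "z \<in> mspace Z" for x z
    proof (rule ccontr)
      assume "(x, z) \<notin> J"
      then have "(x, z) \<in> mspace X \<times> mspace Z - J" using x z by simp
      moreover have "openin (prod_mtopology X Z) (mspace X \<times> mspace Z - J)"
        using openin_diff[OF openin_topspace J(1)] by simp
      ultimately obtain A B where A: "openin (mtopology_of X) A" "x \<in> A" and "z \<in> B"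
        and AB: "A \<times> B \<subseteq> mspace X \<times> mspace Z - J"
        unfolding openin_prod_topology_alt by blast
      obtain r where r: "r > 0" "\<forall>y\<in>mspace X. mdist X x y < r \<longrightarrow> y \<in> A"
        using A unfolding openin_mtopology_of by meson
      \<comment> \<open>Closeness at time \<open>0\<close> puts \<open>x'\<close> inside the ball
        contained in \<open>A\<close>; the bound \<open>r / 2\<close> turns the non-strict
        inequality into a strict one.\<close>
      have "(x, z) \<in> fibre_neighbourhood X T \<pi> J (r / 2)"
        using fibre_neighbourhood_full[OF assms(1,2,3) E F assms(4) J full, of "r / 2"] r(1) x z by auto
      then obtain x' where x': "(x', z) \<in> J"
        and d: "\<And>n. mdist X (int_iter X T n x) (int_iter X T n x') \<le> r / 2"
        unfolding fibre_neighbourhood_def by blast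
      have "x' \<in> A" using r d[of 0] x' JXZ by auto
      then show False using AB x' \<open>z \<in> B\<close> by blast
    qed
    then have "J = mspace X \<times> mspace Z" using JXZ by auto
    then show "J \<in> {mspace X \<times> mspace Z}" by simp
  next
    fix J assume "J \<in> {mspace X \<times> mspace Z}"
    then have J: "J = mspace X \<times> mspace Z" by simp
    have "T ` mspace X = mspace X" "S ` mspace Z = mspace Z"
      using dyn_system_bij_betw[OF sX] dyn_system_bij_betw[OF sZ] by (simp_all add: bij_betw_def)
    then have inv: "map_prod T S ` J = J" unfolding J by (rule map_prod_surj_on)
    have "closedin (prod_mtopology X Z) J"
      using closedin_topspace[of "prod_mtopology X Z"] by (simp add: J)
    moreover have "fst ` J = mspace X" "snd ` J = mspace Z" using empty by (auto simp: J)
    ultimately have "joining X T Z S J" using inv by (simp add: joining_def)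
    moreover have "map_prod q s ` J = mspace Xeq \<times> mspace Zeq"
      unfolding J by (rule map_prod_surj_on[OF factor_map_image[OF q] factor_map_image[OF s]])
    ultimately show "J \<in> {J. joining X T Z S J \<and> map_prod q s ` J = mspace Xeq \<times> mspace Zeq}" by simp
  qed
qed

end
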